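(* Let $D$ be a symmetric union diagram with $n$ components. If $D$ has no crossings on the axis, then $$W_D(s,t)=\left(\frac{s^{1/2}+s^{-1/2}}{t^{1/2}+t^{-1/2}}\right)^{n-1}V_L(t),$$ where $V_L(t)$ is the Jones polynomial of the link $L$ represented by $D$. If $D$ has a crossing on the axis, then, denoting by $D_h$ and $D_v$ the diagrams obtained from $D$ by the horizontal and the vertical smoothing of this crossing, we have $$W(D)=-s^{1/2}\,W(D_h)-s\,W(D_v)\quad\text{if the crossing is of type }X_o,$$ $$W(D)=-s^{-1/2}\,W(D_h)-s^{-1}\,W(D_v)\quad\text{if the crossing is of type }X_u.$$
   Context: Diagrams: we consider planar link diagrams in $\mathbb{R}^2$ transverse to the axis $\{0\}\times\mathbb{R}$; crossings may lie on the axis. Let $\rho(x,y)=(-x,y)$. A diagram is symmetric if $\rho(D)=D$ (including over/under information) except for crossings on the axis, which are necessarily reversed by $\rho$. A symmetric union is a symmetric diagram such that each component is mapped to itself by $\rho$ with reversed orientation; equivalently each component perpendicularly traverses the axis in exactly two points that are not crossings. Crossings on the axis: such a crossing has two ends on the left and two on the right. It is of type $X_o$ if the overstrand runs from upper left to lower right, $X_u$ if it runs from lower left to upper right. The horizontal smoothing $h$ joins upper left to upper right and lower left to lower right; the vertical smoothing $v$ joins the two left ends to each other and the two right ends to each other (without meeting the axis). $W$: the bracket $\langle D\rangle\in\mathbb{Z}(A,B)$ is defined (forgetting orientations) by: (A) for a crossing off the axis, $\langle D\rangle=A\langle D_A\rangle+A^{-1}\langle D_B\rangle$, where $D_A$ is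 the smoothing joining the two regions swept out when the overstrand is turned counterclockwise to the understrand, $D_B$ the other smoothing; (B) on the axis, $\langle X_o\rangle=B\langle h\rangle+B^{-1}\langle v\rangle$ and $\langle X_u\rangle=B^{-1}\langle h\rangle+B\langle v\rangle$; (C) for $n$ disjoint circles without crossings meeting the axis in $2m$ points, $\langle C\rangle=(-A^2-A^{-2})^{n-m}(-B^2-B^{-2})^{m-1}$. For oriented $D$ let $\alpha(D)$ (resp. $\beta(D)$) be the sum of crossing signs off (resp. on) the axis, and $W(D)=W_D=\langle D\rangle(-A^{-3})^{\alpha(D)}(-B^{-3})^{\beta(D)}$, rewritten via $A^2=t^{-1/2}$, $B^2=s^{-1/2}$. For symmetric union diagrams $W(D)$ does not depend on the chosen orientation of the components. $V_L$ is normalized to $1$ on the unknot (and $V=t+t^3-t^4$ for the trefoil with positive crossings). *)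

theory Defs
  imports "HOL-Computational_Algebra.Polynomial" "HOL-Computational_Algebra.Fraction_Field"
begin

section \<open>Rotation codes\<close>

text \<open>
  A rotation code lists, for each vertex of a graph drawn on an oriented closed surface, the names
  of the incident edges in counterclockwise order.  Each edge name occurs exactly twice.
  A dart \<open>(i, k)\<close> is the \<open>k\<close>-th edge end at the \<open>i\<close>-th vertex.
\<close>

type_synonym dart = "nat \<times> nat"

definition darts :: "'l list list \<Rightarrow> dart set" where
  "darts M = {(i, k). i < length M \<and> k < length (M ! i)}"

definition label :: "'l list list \<Rightarrow> dart \<Rightarrow> 'l" where
  "label M d = M ! fst d ! snd d"

definition paired :: "'l list list \<Rightarrow> bool" where
  "paired M \<longleftrightarrow> (\<forall>d\<in>darts M. card {d' \<in> darts M. label M d' = label M d} = 2)"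

definition rot :: "'l list list \<Rightarrow> dart \<Rightarrow> dart" where
  "rot M d = (fst d, Suc (snd d) mod length (M ! fst d))"

definition classes :: "'l list list \<Rightarrow> (dart \<Rightarrow> dart \<Rightarrow> bool) \<Rightarrow> dart set set" where
  "classes M R = darts M // ({(d, d'). d \<in> darts M \<and> d' \<in> darts M \<and> R d d'}\<^sup>*)"

text \<open>
  The face permutation sends a dart \<open>d\<close> to the counterclockwise successor of the other end \<open>e\<close> of
  its edge; its cycles are the boundary walks of the faces.  A connected code describes a drawing
  on the sphere iff its Euler characteristic is 2; in general each connected component must
  contribute 2.
\<close>

definition faces :: "'l list list \<Rightarrow> dart set set" where
  "faces M = classes M
     (\<lambda>d d'. \<exists>e\<in>darts M. e \<noteq> d \<and> label M e = label M d \<and> d' = rot M e)"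

definition pieces :: "'l list list \<Rightarrow> dart set set" where
  "pieces M = classes M (\<lambda>d d'. fst d = fst d' \<or> label M d = label M d')"

definition genus_zero :: "'l list list \<Rightarrow> bool" where
  "genus_zero M \<longleftrightarrow>
     int (length M) - int (card (label M ` darts M)) + int (card (faces M))
       = 2 * int (card (pieces M))"


section \<open>Link diagrams transverse to the axis\<close>

text \<open>
  A diagram transverse to the axis is recorded, up to isotopies of the plane preserving the axis,
  as a list of nodes whose arguments name the edges ending there.  The nodes on the axis
  (constructors \<open>Over\<close>, \<open>Under\<close>, \<open>Traverse\<close>) occur in the list from top to bottom; the position
  of the remaining nodes in the list has no meaning.

    \<^item> \<open>Cross a b c d\<close>: a crossing off the axis, ends in counterclockwise order, \<open>a\<close> and \<open>c\<close> being
      the ends of the understrand, \<open>b\<close> and \<open>d\<close> those of the overstrand.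
    \<^item> \<open>Over ul ll lr ur\<close>, \<open>Under ul ll lr ur\<close>: a crossing on the axis of type $X_o$ resp. $X_u$
      (overstrand from upper left to lower right resp. from lower left to upper right),
      with its upper left, lower left, lower right and upper right end.
    \<^item> \<open>Traverse l r\<close>: a point on the axis that is not a crossing.
    \<^item> \<open>Plain a b\<close>: a point of a strand that is neither a crossing nor on the axis.  Such points
      carry no information; they serve as traces of smoothed crossings, so that circles without
      crossings and axis points still have a node.
\<close>

datatype 'e node =
    Cross 'e 'e 'e 'e
  | Over 'e 'e 'e 'e
  | Under 'e 'e 'e 'e
  | Traverse 'e 'e
  | Plain 'e 'e

type_synonym 'e diagram = "'e node list"

fun ends :: "'e node \<Rightarrow> 'e list" where
  "ends (Cross a b c d) = [a, b, c, d]"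
| "ends (Over ul ll lr ur) = [ul, ll, lr, ur]"
| "ends (Under ul ll lr ur) = [ul, ll, lr, ur]"
| "ends (Traverse l r) = [l, r]"
| "ends (Plain a b) = [a, b]"

definition code :: "'e diagram \<Rightarrow> 'e list list" where
  "code D = map ends D"

fun on_axis :: "'e node \<Rightarrow> bool" where
  "on_axis (Cross _ _ _ _) = False"
| "on_axis (Plain _ _) = False"
| "on_axis _ = True"

fun axis_crossing :: "'e node \<Rightarrow> bool" where
  "axis_crossing (Over _ _ _ _) = True"
| "axis_crossing (Under _ _ _ _) = True"
| "axis_crossing _ = False"

text \<open>
  The rotation code of the union of the diagram and the axis on the sphere: the axis is cut by its
  nodes into segments \<open>Inr 0, Inr 1, \<dots>\<close> from top to bottom, and the last vertex is the point at
  infinity, where the axis closes up.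
\<close>

fun axis_code :: "nat \<Rightarrow> 'e diagram \<Rightarrow> ('e + nat) list list" where
  "axis_code j [] = [[Inr j, Inr 0]]"
| "axis_code j (Cross a b c d # ns) = [Inl a, Inl b, Inl c, Inl d] # axis_code j ns"
| "axis_code j (Over ul ll lr ur # ns) =
     [Inr j, Inl ul, Inl ll, Inr (Suc j), Inl lr, Inl ur] # axis_code (Suc j) ns"
| "axis_code j (Under ul ll lr ur # ns) =
     [Inr j, Inl ul, Inl ll, Inr (Suc j), Inl lr, Inl ur] # axis_code (Suc j) ns"
| "axis_code j (Traverse l r # ns) = [Inr j, Inl l, Inr (Suc j), Inl r] # axis_code (Suc j) ns"
| "axis_code j (Plain a b # ns) = [Inl a, Inl b] # axis_code j ns"

text \<open>\<open>left_edges D L\<close>: the edges in \<open>L\<close> can be taken to be those in the left half-plane.\<close>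

fun node_sides :: "'e set \<Rightarrow> 'e node \<Rightarrow> bool" where
  "node_sides L (Cross a b c d) \<longleftrightarrow> {a, b, c, d} \<subseteq> L \<or> {a, b, c, d} \<inter> L = {}"
| "node_sides L (Over ul ll lr ur) \<longleftrightarrow> {ul, ll} \<subseteq> L \<and> {ur, lr} \<inter> L = {}"
| "node_sides L (Under ul ll lr ur) \<longleftrightarrow> {ul, ll} \<subseteq> L \<and> {ur, lr} \<inter> L = {}"
| "node_sides L (Traverse l r) \<longleftrightarrow> l \<in> L \<and> r \<notin> L"
| "node_sides L (Plain a b) \<longleftrightarrow> {a, b} \<subseteq> L \<or> {a, b} \<inter> L = {}"

definition left_edges :: "'e diagram \<Rightarrow> 'e set \<Rightarrow> bool" where
  "left_edges D L \<longleftrightarrow> (\<forall>N\<in>set D. node_sides L N)"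

definition link_diagram :: "'e diagram \<Rightarrow> bool" where
  "link_diagram D \<longleftrightarrow>
     D \<noteq> [] \<and> paired (code D) \<and> (\<exists>L. left_edges D L) \<and> genus_zero (axis_code 0 D)"


section \<open>Components and orientations\<close>

text \<open>The other end of the strand passing through a node.\<close>

definition thru :: "'e diagram \<Rightarrow> dart \<Rightarrow> dart" where
  "thru D d = (let m = length (ends (D ! fst d)) in (fst d, (snd d + m div 2) mod m))"

definition components :: "'e diagram \<Rightarrow> dart set set" where
  "components D =
     classes (code D) (\<lambda>d d'. label (code D) d = label (code D) d' \<or> d' = thru D d)"

text \<open>In an orientation, \<open>out d\<close> says that the strand leaves the node \<open>fst d\<close> through the end \<open>d\<close>.\<close>

definition orientation :: "'e diagram \<Rightarrow> (dart \<Rightarrow> bool) \<Rightarrow> bool" where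
  "orientation D out \<longleftrightarrow>
     (\<forall>d\<in>darts (code D). out (thru D d) \<noteq> out d) \<and>
     (\<forall>d\<in>darts (code D). \<forall>d'\<in>darts (code D).
        d \<noteq> d' \<and> label (code D) d = label (code D) d' \<longrightarrow> out d \<noteq> out d')"

text \<open>
  A crossing is positive iff the overstrand has to be turned counterclockwise (by less than a
  half-turn) to match the direction of the understrand.
\<close>

fun crossing_sign :: "'e node \<Rightarrow> (nat \<Rightarrow> bool) \<Rightarrow> int" where
  "crossing_sign (Cross a b c d) out = (if out 1 = out 2 then 1 else - 1)"
| "crossing_sign (Over ul ll lr ur) out = (if out 2 = out 3 then 1 else - 1)"
| "crossing_sign (Under ul ll lr ur) out = (if out 1 = out 2 then 1 else - 1)"
| "crossing_sign (Traverse l r) out = 0"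
| "crossing_sign (Plain a b) out = 0"

definition off_axis_writhe :: "'e diagram \<Rightarrow> (dart \<Rightarrow> bool) \<Rightarrow> int" where
  "off_axis_writhe D out =
     (\<Sum>i | i < length D \<and> \<not> axis_crossing (D ! i). crossing_sign (D ! i) (\<lambda>k. out (i, k)))"

definition on_axis_writhe :: "'e diagram \<Rightarrow> (dart \<Rightarrow> bool) \<Rightarrow> int" where
  "on_axis_writhe D out =
     (\<Sum>i | i < length D \<and> axis_crossing (D ! i). crossing_sign (D ! i) (\<lambda>k. out (i, k)))"


section \<open>Symmetric unions\<close>

text \<open>
  \<open>reflection D r\<close>: the map \<open>r\<close> on darts is induced by $\rho(x,y) = (-x,y)$.  It respects edges,
  interchanges the two half-planes, fixes each node on the axis while interchanging its left and
  right ends, and sends each node off the axis to one of the same kind.  Since $\rho$ reverses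
  cyclic orders and over/under information is kept off the axis, \<open>Cross a b c d\<close> has to go to
  \<open>Cross a' d' c' b'\<close> or, equivalently, \<open>Cross c' b' a' d'\<close>, where primes denote images;
  this is the role of \<open>s\<close>.  At a crossing on the axis the ends 0, 2 and 1, 3 of the two strands are
  interchanged, that is, \<open>r\<close> reverses the crossing.
\<close>

definition reflection :: "'e diagram \<Rightarrow> (dart \<Rightarrow> dart) \<Rightarrow> bool" where
  "reflection D r \<longleftrightarrow>
     (\<forall>d\<in>darts (code D). r d \<in> darts (code D) \<and> r (r d) = d) \<and>
     (\<forall>d\<in>darts (code D). \<forall>d'\<in>darts (code D).
        label (code D) d = label (code D) d' \<longrightarrow> label (code D) (r d) = label (code D) (r d')) \<and>
     (\<exists>L. left_edges D L \<and>
        (\<forall>d\<in>darts (code D). label (code D) (r d) \<in> L \<longleftrightarrow> label (code D) d \<notin> L)) \<and>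
     (\<forall>i<length D. let m = length (ends (D ! i)) in
        if on_axis (D ! i) then \<forall>k<m. r (i, k) = (i, m - 1 - k)
        else \<exists>j<length D. \<exists>s\<in>{0, m div 2}.
               \<not> on_axis (D ! j) \<and> length (ends (D ! j)) = m \<and>
               (\<forall>k<m. r (i, k) = (j, (s + m - k) mod m)))"

text \<open>Each component is mapped to itself with reversed orientation.\<close>

definition symmetric_union :: "'e diagram \<Rightarrow> bool" where
  "symmetric_union D \<longleftrightarrow> link_diagram D \<and>
     (\<exists>r. reflection D r \<and>
        (\<forall>K\<in>components D. r ` K = K) \<and>
        (\<forall>out. orientation D out \<longrightarrow> (\<forall>d\<in>darts (code D). out (r d) \<noteq> out d)))"


section \<open>Smoothings of crossings on the axis\<close>

fun h_node :: "'e node \<Rightarrow> 'e node list" where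
  "h_node (Over ul ll lr ur) = [Traverse ul ur, Traverse ll lr]"
| "h_node (Under ul ll lr ur) = [Traverse ul ur, Traverse ll lr]"
| "h_node N = [N]"

fun v_node :: "'e node \<Rightarrow> 'e node list" where
  "v_node (Over ul ll lr ur) = [Plain ul ll, Plain ur lr]"
| "v_node (Under ul ll lr ur) = [Plain ul ll, Plain ur lr]"
| "v_node N = [N]"

definition h_smoothing :: "'e diagram \<Rightarrow> nat \<Rightarrow> 'e diagram" where
  "h_smoothing D i = take i D @ h_node (D ! i) @ drop (Suc i) D"

definition v_smoothing :: "'e diagram \<Rightarrow> nat \<Rightarrow> 'e diagram" where
  "v_smoothing D i = take i D @ v_node (D ! i) @ drop (Suc i) D"


section \<open>The bracket, $W$ and the Jones polynomial\<close>

text \<open>The field $\mathbb{Z}(A,B)$.\<close>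

type_synonym ZAB = "int poly poly fract"

definition varA :: ZAB where "varA = Fract [:[:0, 1:]:] 1"
definition varB :: ZAB where "varB = Fract [:0, 1:] 1"

text \<open>The variables $s$, $t$ are given by $A^2 = t^{-1/2}$, $B^2 = s^{-1/2}$.\<close>

definition sqrt_t :: ZAB where "sqrt_t = inverse (varA ^ 2)"
definition sqrt_s :: ZAB where "sqrt_s = inverse (varB ^ 2)"

definition circles_value :: "'e diagram \<Rightarrow> ZAB" where
  "circles_value C =
     (let n = int (card (components C));
          m = int (length (filter on_axis C) div 2)
      in (- (varA ^ 2) - inverse (varA ^ 2)) powi (n - m) *
         (- (varB ^ 2) - inverse (varB ^ 2)) powi (m - 1))"

text \<open>
  The crossings in the second argument are smoothed in turn.  Turning the overstrand of
  \<open>Cross a b c d\<close> counterclockwise to the understrand sweeps out the regions between \<open>b\<close>, \<open>c\<close> and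
  between \<open>d\<close>, \<open>a\<close>; joining these two regions connects \<open>a\<close> with \<open>b\<close> and \<open>c\<close> with \<open>d\<close>.
\<close>

fun bracket_from :: "'e diagram \<Rightarrow> 'e diagram \<Rightarrow> ZAB" where
  "bracket_from C [] = circles_value C"
| "bracket_from C (Cross a b c d # ns) =
     varA * bracket_from (C @ [Plain a b, Plain c d]) ns +
     inverse varA * bracket_from (C @ [Plain a d, Plain b c]) ns"
| "bracket_from C (Over ul ll lr ur # ns) =
     varB * bracket_from (C @ h_node (Over ul ll lr ur)) ns +
     inverse varB * bracket_from (C @ v_node (Over ul ll lr ur)) ns"
| "bracket_from C (Under ul ll lr ur # ns) =
     inverse varB * bracket_from (C @ h_node (Under ul ll lr ur)) ns +
     varB * bracket_from (C @ v_node (Under ul ll lr ur)) ns"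
| "bracket_from C (Traverse l r # ns) = bracket_from (C @ [Traverse l r]) ns"
| "bracket_from C (Plain a b # ns) = bracket_from (C @ [Plain a b]) ns"

definition bracket :: "'e diagram \<Rightarrow> ZAB" where
  "bracket D = bracket_from [] D"

definition W :: "'e diagram \<Rightarrow> (dart \<Rightarrow> bool) \<Rightarrow> ZAB" where
  "W D out = bracket D * (- inverse (varA ^ 3)) powi off_axis_writhe D out
                       * (- inverse (varB ^ 3)) powi on_axis_writhe D out"

text \<open>
  The Jones polynomial of the oriented link represented by a diagram, by Kauffman's construction:
  the axis is forgotten, a crossingless diagram of \<open>n\<close> circles has value
  $(-A^2-A^{-2})^{n-1}$, and the bracket is normalised by the writhe and evaluated
  at $t^{1/2} = A^{-2}$.
\<close>

fun forget_axis :: "'e node \<Rightarrow> 'e node" where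
  "forget_axis (Over ul ll lr ur) = Cross ll lr ur ul"
| "forget_axis (Under ul ll lr ur) = Cross ul ll lr ur"
| "forget_axis (Traverse l r) = Plain l r"
| "forget_axis N = N"

fun kauffman_from :: "'e diagram \<Rightarrow> 'e diagram \<Rightarrow> ZAB" where
  "kauffman_from C [] = (- (varA ^ 2) - inverse (varA ^ 2)) ^ (card (components C) - 1)"
| "kauffman_from C (Cross a b c d # ns) =
     varA * kauffman_from (C @ [Plain a b, Plain c d]) ns +
     inverse varA * kauffman_from (C @ [Plain a d, Plain b c]) ns"
| "kauffman_from C (N # ns) = kauffman_from (C @ [N]) ns"

definition jones :: "'e diagram \<Rightarrow> (dart \<Rightarrow> bool) \<Rightarrow> ZAB" where
  "jones D out = kauffman_from [] (map forget_axis D) *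
     (- inverse (varA ^ 3)) powi (off_axis_writhe D out + on_axis_writhe D out)"

end

theory Submission
  imports Defs
begin

text \<open>
  In a symmetric union the crossings off the axis come in mirror pairs of opposite sign, so the
  off-axis writhe vanishes, and a crossing on the axis is positive for type $X_o$ and negative for
  type $X_u$.  Both facts only use that the reflection reverses the orientation, and every
  orientation of a smoothing at an axis crossing still has this property.  Hence smoothing leaves
  the off-axis writhe unchanged and removes exactly one sign from the on-axis writhe, and the
  bracket rule on the axis becomes the skein relation of \<open>W\<close>.

  Without crossings on the axis, the reflection acts on each component as a reflection of a
  circle, and the component meets the axis in exactly two points, so every state meets it in
  \<open>2n\<close> points.  State by state the bracket then differs from Kauffman's by the ratio of the two
  circle values to the power \<open>n - 1\<close>.
\<close>

section \<open>Components, reflections and orientations\<close>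

lemma length_ends: "length (ends N) = 2 \<or> length (ends N) = 4"
  by (cases N) auto

lemma mem_darts_code:
  "d \<in> darts (code D) \<longleftrightarrow> fst d < length D \<and> snd d < length (ends (D ! fst d))"
  by (cases d) (auto simp: darts_def code_def)

lemma label_code: "i < length D \<Longrightarrow> label (code D) (i, k) = ends (D ! i) ! k"
  by (simp add: label_def code_def)

lemma finite_darts: "finite (darts M)"
proof (rule finite_subset)
  show "darts M \<subseteq> (SIGMA i:{..<length M}. {..<length (M ! i)})"
    by (auto simp: darts_def)
qed auto

lemma fst_thru [simp]: "fst (thru D d) = fst d"
  by (simp add: thru_def Let_def)

text \<open>Every node has two or four ends, so the modular identities for end indices below are
  settled by a finite check.\<close>

lemma less_2_or_4_cases:
  assumes "k < m" "m = 2 \<or> m = (4::nat)"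
  shows "(m = 2 \<and> (k = 0 \<or> k = 1)) \<or> (m = 4 \<and> (k = 0 \<or> k = 1 \<or> k = 2 \<or> k = 3))"
  using assms by auto

lemma thru_in_darts: "d \<in> darts (code D) \<Longrightarrow> thru D d \<in> darts (code D)"
  using length_ends[of "D ! fst d"] by (auto simp: mem_darts_code thru_def Let_def)

lemma thru_thru: "d \<in> darts (code D) \<Longrightarrow> thru D (thru D d) = d"
  using less_2_or_4_cases[OF _ length_ends, of "snd d" "D ! fst d"]
  by (auto simp: mem_darts_code thru_def Let_def prod_eq_iff)

section \<open>Components as classes of darts under steps along strands\<close>

definition strand_step :: "'e diagram \<Rightarrow> (dart \<times> dart) set" where
  "strand_step D = {(d, d'). d \<in> darts (code D) \<and> d' \<in> darts (code D) \<and>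
     (label (code D) d = label (code D) d' \<or> d' = thru D d)}"

lemma components_alt: "components D = darts (code D) // (strand_step D)\<^sup>*"
  by (simp add: components_def classes_def strand_step_def)

lemma sym_strand_step: "sym (strand_step D)"
  by (auto simp: sym_def strand_step_def thru_thru)

text \<open>Both darts are reached from a representative of the class, and the symmetry of the steps
  allows one of the paths to be walked backwards.\<close>

lemma component_connected:
  assumes "K \<in> components D" "x \<in> K" "y \<in> K"
  shows "(x, y) \<in> (strand_step D)\<^sup>*"
proof -
  obtain z where "(z, x) \<in> (strand_step D)\<^sup>*" "(z, y) \<in> (strand_step D)\<^sup>*"
    using assms unfolding components_alt by (auto elim!: quotientE)
  then show ?thesis
    using symD[OF sym_rtrancl[OF sym_strand_step]] rtrancl_trans by metis
qed

lemma component_closed: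
  "K \<in> components D \<Longrightarrow> x \<in> K \<Longrightarrow> (x, y) \<in> (strand_step D)\<^sup>* \<Longrightarrow> y \<in> K"
  unfolding components_alt by (auto elim!: quotientE)

lemma component_subset: 
  assumes "K \<in> components D" shows "K \<subseteq> darts (code D)"
proof
  fix y assume "y \<in> K"
  with assms obtain x where "x \<in> darts (code D)" "(x, y) \<in> (strand_step D)\<^sup>*"
    unfolding components_alt by (auto elim!: quotientE)
  from this(2,1) show "y \<in> darts (code D)"
    by (induction rule: rtrancl_induct) (auto simp: strand_step_def)
qed

lemma obtain_component:
  assumes "d \<in> darts (code D)"
  obtains K where "K \<in> components D" "d \<in> K"
  using assms unfolding components_alt by (auto simp: quotient_def)

text \<open>Transport principle for properties along a component. It is applied to the agreement of
  two orientations and to the property of being reversed by \<open>r\<close>; \<open>edge\<close> is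
  restricted to distinct darts because the edge condition of an orientation is.\<close>

lemma component_invariant:
  assumes K: "K \<in> components D" "x \<in> K" "y \<in> K"
    and edge: "\<And>d d'. d \<in> K \<Longrightarrow> d' \<in> K \<Longrightarrow> d \<noteq> d' \<Longrightarrow>
      label (code D) d = label (code D) d' \<Longrightarrow> P d = P d'"
    and thru: "\<And>d. d \<in> K \<Longrightarrow> P (thru D d) = P d"
  shows "P x = P y"
proof -
  have "(x, y) \<in> (strand_step D)\<^sup>*"
    using K by (rule component_connected)
  then have "y \<in> K \<and> P x = P y"
  proof (induction rule: rtrancl_induct)
    case (step y z)
    then have "z \<in> K"
      using component_closed[OF K(1)] by blast
    with step edge[of y z] thru[of y] show ?case
      by (auto simp: strand_step_def)
  qed (use K in simp)
  then show ?thesis ..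
qed

section \<open>Elementary properties of the reflection\<close>

lemma reflection_in_darts:
  "reflection D r \<Longrightarrow> d \<in> darts (code D) \<Longrightarrow> r d \<in> darts (code D)"
  by (simp add: reflection_def)

lemma reflection_involution:
  "reflection D r \<Longrightarrow> d \<in> darts (code D) \<Longrightarrow> r (r d) = d"
  by (simp add: reflection_def)

lemma reflection_label:
  "reflection D r \<Longrightarrow> d \<in> darts (code D) \<Longrightarrow> d' \<in> darts (code D) \<Longrightarrow>
    label (code D) d = label (code D) d' \<Longrightarrow> label (code D) (r d) = label (code D) (r d')"
  unfolding reflection_def by blast

lemma reflection_on_axis:
  "reflection D r \<Longrightarrow> i < length D \<Longrightarrow> on_axis (D ! i) \<Longrightarrow> k < length (ends (D ! i)) \<Longrightarrow>
    r (i, k) = (i, length (ends (D ! i)) - 1 - k)"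
  by (simp add: reflection_def Let_def)

lemma reflection_off_axis:
  assumes r: "reflection D r" and i: "i < length D" and off: "\<not> on_axis (D ! i)"
    and m: "m = length (ends (D ! i))"
  obtains j s where "j < length D" "s = 0 \<or> s = m div 2" "\<not> on_axis (D ! j)"
    "length (ends (D ! j)) = m" "\<And>k. k < m \<Longrightarrow> r (i, k) = (j, (s + m - k) mod m)"
proof -
  have "\<forall>i<length D. let m = length (ends (D ! i)) in
        if on_axis (D ! i) then \<forall>k<m. r (i, k) = (i, m - 1 - k)
        else \<exists>j<length D. \<exists>s\<in>{0, m div 2}.
               \<not> on_axis (D ! j) \<and> length (ends (D ! j)) = m \<and>
               (\<forall>k<m. r (i, k) = (j, (s + m - k) mod m))"
    using r unfolding reflection_def by (elim conjE)
  from this[rule_format, OF i] off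
  have "\<exists>j<length D. \<exists>s\<in>{0, m div 2}. \<not> on_axis (D ! j) \<and> length (ends (D ! j)) = m \<and>
               (\<forall>k<m. r (i, k) = (j, (s + m - k) mod m))"
    unfolding Let_def m by (simp only: if_False)
  then show ?thesis
    using that by (elim exE bexE conjE) (simp only: insert_iff empty_iff, blast)
qed

lemma reflection_sides:
  assumes "reflection D r"
  obtains L where "left_edges D L"
    "\<forall>d\<in>darts (code D). label (code D) (r d) \<in> L \<longleftrightarrow> label (code D) d \<notin> L"
  using assms unfolding reflection_def by (elim conjE exE) (rule that)

text \<open>No edge is its own mirror image, since \<open>r\<close> interchanges the two
  half-planes.\<close>

lemma reflection_label_neq:
  assumes "reflection D r" "d \<in> darts (code D)"
  shows "label (code D) (r d) \<noteq> label (code D) d"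
  using reflection_sides[OF assms(1)] assms(2) by metis

text \<open>On the end indices \<open>thru\<close> is the half-turn \<open>k + m div 2\<close>,
  which commutes modulo \<open>m\<close> with every map of the form \<open>c - k\<close>; both cases
  of \<open>reflection\<close> have this form.\<close>

lemma reflection_thru:
  assumes r: "reflection D r" and d: "d \<in> darts (code D)"
  shows "r (thru D d) = thru D (r d)"
proof -
  obtain i k where ik: "d = (i, k)" by (cases d)
  define m where "m = length (ends (D ! i))"
  have i: "i < length D" and k: "k < m"
    using d by (auto simp: ik mem_darts_code m_def)
  have c: "(m = 2 \<and> (k = 0 \<or> k = 1)) \<or> (m = 4 \<and> (k = 0 \<or> k = 1 \<or> k = 2 \<or> k = 3))"
    using less_2_or_4_cases[OF k] length_ends m_def by blast
  have k': "(k + m div 2) mod m < m"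
    using k by simp
  show ?thesis
  proof (cases "on_axis (D ! i)")
    case True
    show ?thesis
      using reflection_on_axis[OF r i True] k k' c 
      by (auto simp: ik thru_def Let_def m_def[symmetric])
  next
    case False
    obtain j s where s: "s = 0 \<or> s = m div 2" and j: "length (ends (D ! j)) = m"
      and rj: "\<And>k. k < m \<Longrightarrow> r (i, k) = (j, (s + m - k) mod m)"
      using reflection_off_axis[OF r i False m_def] by metis
    show ?thesis
      using rj[OF k] rj[OF k'] s c j by (auto simp: ik thru_def Let_def m_def[symmetric])
  qed
qed

text \<open>Off the axis \<open>thru\<close> stays in one half-plane while \<open>r\<close> changes
  it. At an axis crossing \<open>3 - k\<close> and \<open>k + 2\<close> have different parity; at a
  traversal both maps swap the two ends. So the points on the axis that are not crossings are
  detected by \<open>r\<close> and \<open>thru\<close> alone.\<close>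

lemma reflection_eq_thru_iff:
  assumes r: "reflection D r" and d: "d \<in> darts (code D)"
  shows "r d = thru D d \<longleftrightarrow> on_axis (D ! fst d) \<and> \<not> axis_crossing (D ! fst d)"
proof -
  obtain i k where ik: "d = (i, k)" by (cases d)
  define m where "m = length (ends (D ! i))"
  have i: "i < length D" and k: "k < m"
    using d by (auto simp: ik mem_darts_code m_def)
  have c: "(m = 2 \<and> (k = 0 \<or> k = 1)) \<or> (m = 4 \<and> (k = 0 \<or> k = 1 \<or> k = 2 \<or> k = 3))"
    using less_2_or_4_cases[OF k] length_ends m_def by blast
  show ?thesis
  proof (cases "on_axis (D ! i)")
    case True
    then have "axis_crossing (D ! i) \<longleftrightarrow> m = 4"
      by (cases "D ! i") (auto simp: m_def)
    with True show ?thesis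
      using reflection_on_axis[OF r i True] k c 
      by (auto simp: ik thru_def Let_def m_def[symmetric])
  next
    case False
    obtain L where L: "left_edges D L"
      and flip: "\<forall>d\<in>darts (code D). label (code D) (r d) \<in> L \<longleftrightarrow> label (code D) d \<notin> L"
      using reflection_sides[OF r] by blast
    have "node_sides L (D ! i)"
      using L i by (auto simp: left_edges_def)
    then have side: "ends (D ! i) ! k \<in> L \<longleftrightarrow> ends (D ! i) ! k' \<in> L" if "k < m" "k' < m" for k k'
      using False nth_mem[of k "ends (D ! i)"] nth_mem[of k' "ends (D ! i)"] that
      unfolding m_def by (cases "D ! i") auto
    have "r d \<noteq> thru D d"
    proof
      assume "r d = thru D d"
      then have "label (code D) (thru D d) \<in> L \<longleftrightarrow> label (code D) d \<notin> L"
        using flip d by (metis (full_types))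
      with side[OF k, of "(k + m div 2) mod m"] k i show False
        by (auto simp: ik thru_def Let_def m_def[symmetric] label_code)
    qed
    with False show ?thesis by (simp add: ik)
  qed
qed

section \<open>Orientations and their reversal by the reflection\<close>

lemma orientation_thru: "orientation D out \<Longrightarrow> d \<in> darts (code D) \<Longrightarrow> out (thru D d) \<noteq> out d"
  by (simp add: orientation_def)

lemma orientation_edge:
  "orientation D out \<Longrightarrow> d \<in> darts (code D) \<Longrightarrow> d' \<in> darts (code D) \<Longrightarrow> d \<noteq> d' \<Longrightarrow>
    label (code D) d = label (code D) d' \<Longrightarrow> out d \<noteq> out d'"
  unfolding orientation_def by blast

text \<open>
  Here \<open>u\<close> is an orientation of the horizontal or the vertical smoothing at \<open>i\<close>, read off on the
  darts of \<open>D\<close>.  In the vertical case, if \<open>u\<close> were not reversed at the node \<open>i\<close>, then its agreement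
  with \<open>out\<close> would be constant along each strand through \<open>i\<close> but differ on the two strands,
  although both lie on the same component.
\<close>

lemma reversed_after_smoothing:
  fixes u :: "dart \<Rightarrow> bool"
  assumes r: "reflection D r" and rK: "\<forall>K\<in>components D. r ` K = K"
    and out: "orientation D out"
    and rev: "\<forall>d\<in>darts (code D). out (r d) \<noteq> out d"
    and i: "i < length D" "axis_crossing (D ! i)"
    and u_edge: "\<forall>d\<in>darts (code D). \<forall>d'\<in>darts (code D).
      d \<noteq> d' \<and> label (code D) d = label (code D) d' \<longrightarrow> u d \<noteq> u d'"
    and u_thru: "\<forall>d\<in>darts (code D). fst d \<noteq> i \<longrightarrow> u (thru D d) \<noteq> u d"
    and u_i: "(u (i, 0) \<noteq> u (i, 3) \<and> u (i, 1) \<noteq> u (i, 2)) \<or>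
      (u (i, 0) \<noteq> u (i, 1) \<and> u (i, 2) \<noteq> u (i, 3))"
    and d: "d \<in> darts (code D)"
  shows "u (r d) \<noteq> u d"
proof -
  note rK = bspec[OF rK] and rev = bspec[OF rev] and u_thru = bspec[OF u_thru, THEN mp]
  have u_edge: "u d \<noteq> u d'" if "d \<in> darts (code D)" "d' \<in> darts (code D)" "d \<noteq> d'"
      "label (code D) d = label (code D) d'" for d d'
    using u_edge that by blast
  have m: "length (ends (D ! i)) = 4" and ax: "on_axis (D ! i)"
    using i by (cases "D ! i"; simp)+
  have four: "k < 4 \<longleftrightarrow> k = 0 \<or> k = 1 \<or> k = 2 \<or> k = (3::nat)" for k
    by auto
  have ri: "r (i, 0) = (i, 3)" "r (i, 1) = (i, 2)" "r (i, 2) = (i, 1)" "r (i, 3) = (i, 0)"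
    using reflection_on_axis[OF r i(1) ax, unfolded m] by simp_all
  have di: "(i, k) \<in> darts (code D) \<longleftrightarrow> k < 4" for k
    using i m by (simp add: mem_darts_code)
  have ti: "thru D (i, 0) = (i, 2)" "thru D (i, 1) = (i, 3)"
    "thru D (i, 2) = (i, 0)" "thru D (i, 3) = (i, 1)"
    by (simp_all add: thru_def m)
  define f where "f d \<longleftrightarrow> (u d \<longleftrightarrow> out d)" for d
  have f_edge: "f d = f d'" if "d \<in> darts (code D)" "d' \<in> darts (code D)" "d \<noteq> d'"
      "label (code D) d = label (code D) d'" for d d'
    using u_edge[OF that] orientation_edge[OF out that] by (auto simp: f_def)
  have f_thru: "f (thru D d) = f d" if "d \<in> darts (code D)" "fst d \<noteq> i" for d
    using u_thru[OF that] orientation_thru[OF out that(1)] by (auto simp: f_def)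
  \<comment> \<open>Reversal by \<open>r\<close> and passage through the crossing together force
    both left ends to point the same way, and both right ends the other way.\<close>
  have out_i: "out (i, 0) = out (i, 1)" "out (i, 2) = out (i, 3)" "out (i, 0) \<noteq> out (i, 2)"
    using rev[of "(i, 0)", unfolded di ri] rev[of "(i, 1)", unfolded di ri]
      orientation_thru[OF out, of "(i, 0)", unfolded di ti]
      orientation_thru[OF out, of "(i, 1)", unfolded di ti] by simp_all
  have u03: "u (i, 0) \<noteq> u (i, 3) \<and> u (i, 1) \<noteq> u (i, 2)"
  proof (rule ccontr)
    assume neg: "\<not> ?thesis"
    with u_i out_i have f_i: "f (i, 0) = f (i, 2)" "f (i, 1) = f (i, 3)" "f (i, 0) \<noteq> f (i, 3)"
      by (auto simp: f_def)
    obtain K where K: "K \<in> components D" "(i, 0) \<in> K"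
      using obtain_component di by (metis zero_less_numeral)
    \<comment> \<open>The reflection swaps the two strands at \<open>i\<close> and preserves
      \<open>K\<close>, so both strands belong to \<open>K\<close>.\<close>
    have "(i, 3) \<in> K"
      using rK[OF K(1)] K(2) ri by force
    have "f (i, 0) = f (i, 3)"
    proof (rule component_invariant[OF K \<open>(i, 3) \<in> K\<close>, of f])
      fix d assume "d \<in> K"
      then have d: "d \<in> darts (code D)"
        using component_subset[OF K(1)] by blast
      show "f (thru D d) = f d"
      proof (cases "fst d = i")
        case True
        with d di[of "snd d"] ti f_i show ?thesis
          by (cases d) (auto simp: four)
      qed (use d f_thru in blast)
    qed (use component_subset[OF K(1)] f_edge in blast)
    with f_i show False by simp
  qed
  obtain K where K: "K \<in> components D" "d \<in> K"
    using obtain_component d by blast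
  have Kd: "K \<subseteq> darts (code D)"
    using component_subset[OF K(1)] .
  have rKmem: "r x \<in> K" if "x \<in> K" for x
    using rK[OF K(1)] that by blast
  show ?thesis
  proof (cases "\<exists>k. (i, k) \<in> K")
    case False
    \<comment> \<open>\<open>K\<close> avoids the node \<open>i\<close>, so \<open>u\<close> is
      equal to \<open>out\<close> on all of \<open>K\<close> or opposite to it on all of
      \<open>K\<close>.\<close>
    have "f (r d) = f d"
    proof (rule component_invariant[OF K(1) rKmem[OF K(2)] K(2), of f])
      fix x assume "x \<in> K"
      then show "f (thru D x) = f x"
        using f_thru[of x] Kd False by (metis prod.collapse subsetD)
    qed (use Kd f_edge in blast)
    with rev[OF d] show ?thesis
      by (auto simp: f_def)
  next
    case True
    then obtain k where k: "(i, k) \<in> K" by blast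
    \<comment> \<open>The reversal property itself is propagated along \<open>K\<close>, starting
      from the ends of \<open>i\<close>, where \<open>u03\<close> gives it.\<close>
    define g where "g x \<longleftrightarrow> u (r x) \<noteq> u x" for x
    have g_i: "g (i, k)" if "k < 4" for k
      using that u03 ri by (auto simp: g_def four)
    have "g d = g (i, k)"
    proof (rule component_invariant[OF K k, of g])
      fix x y assume xy: "x \<in> K" "y \<in> K" "x \<noteq> y" "label (code D) x = label (code D) y"
      then have d: "x \<in> darts (code D)" "y \<in> darts (code D)"
        using Kd by auto
      have "r x \<noteq> r y"
        using reflection_involution[OF r] d xy by metis
      then have "u (r x) \<noteq> u (r y)"
        using u_edge reflection_in_darts[OF r] reflection_label[OF r] d xy by metis
      then show "g x = g y"
        using u_edge[OF d xy(3,4)] by (auto simp: g_def)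
    next
      fix x assume x: "x \<in> K"
      then have d: "x \<in> darts (code D)"
        using Kd by auto
      show "g (thru D x) = g x"
      proof (cases "fst x = i")
        case True
        have "snd x < 4" "snd (thru D x) < 4"
          using d thru_in_darts[OF d] True di[of "snd x"] di[of "snd (thru D x)"]
          by (metis fst_thru prod.collapse)+
        then show ?thesis
          using g_i True by (metis fst_thru prod.collapse)
      next
        case False
        \<comment> \<open>The involution \<open>r\<close> preserves the ends of \<open>i\<close>,
          hence also the complement, so that \<open>u_thru\<close> applies at \<open>r x\<close> as
          well.\<close>
        have "fst (r x) \<noteq> i"
        proof
          assume "fst (r x) = i"
          then have "snd (r x) < 4"
            using reflection_in_darts[OF r d] m by (auto simp: mem_darts_code)
          with \<open>fst (r x) = i\<close> ri have "fst (r (r x)) = i"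
            by (cases "r x") (auto simp: four)
          with False show False
            using reflection_involution[OF r d] by simp
        qed
        then show ?thesis
          using u_thru[OF d False] u_thru[OF reflection_in_darts[OF r d]] reflection_thru[OF r d]
          by (auto simp: g_def)
      qed
    qed
    moreover have "g (i, k)"
      using g_i k Kd di by blast
    ultimately show ?thesis by (simp add: g_def)
  qed
qed


section \<open>Writhes of smoothings\<close>

text \<open>The node map \<open>i \<mapsto> fst (r (i, 0))\<close> is a sign-reversing involution of
  the crossings off the axis, so the sum equals its own negative. The labelling \<open>u\<close>
  need not be an orientation of \<open>D\<close>: it may come from a smoothing and violate the
  strand condition at axis crossings.\<close>

lemma off_axis_sum_zero:
  fixes u :: "dart \<Rightarrow> bool"
  assumes r: "reflection D r"
    and u_rev: "\<forall>d\<in>darts (code D). u (r d) \<noteq> u d"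
    and u_thru: "\<forall>d\<in>darts (code D). \<not> axis_crossing (D ! fst d) \<longrightarrow> u (thru D d) \<noteq> u d"
  shows "(\<Sum>i | i < length D \<and> \<not> axis_crossing (D ! i). crossing_sign (D ! i) (\<lambda>k. u (i, k))) = 0"
proof -
  note u_rev = bspec[OF u_rev] and u_thru = bspec[OF u_thru, THEN mp]
  define c where "c i = crossing_sign (D ! i) (\<lambda>k. u (i, k))" for i
  define S where "S = {i. i < length D \<and> \<not> on_axis (D ! i) \<and> length (ends (D ! i)) = 4}"
  have mate: "fst (r (j, 0)) = i \<and> j \<in> S \<and> c j = - c i" if i: "i \<in> S" and j: "j = fst (r (i, 0))" for i j
  proof -
    have il: "i < length D" and off: "\<not> on_axis (D ! i)" and m: "4 = length (ends (D ! i))"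
      using i by (auto simp: S_def)
    obtain j' s where j': "j' < length D" and s: "s = 0 \<or> s = 4 div 2" and offj: "\<not> on_axis (D ! j')"
      and mj: "length (ends (D ! j')) = 4" and rj: "\<And>k. k < 4 \<Longrightarrow> r (i, k) = (j', (s + 4 - k) mod 4)"
      using reflection_off_axis[OF r il off m] by metis
    have jj: "j' = j"
      using rj[of 0] j by simp
    have dart: "(i, k) \<in> darts (code D)" if "k < 4" for k
      using il m that by (simp add: mem_darts_code)
    have dartj: "(j, k) \<in> darts (code D)" if "k < 4" for k
      using j' mj that jj by (simp add: mem_darts_code)
    obtain a b c' d where N: "D ! i = Cross a b c' d"
      using off m by (cases "D ! i") auto
    obtain a' b' c'' d' where N': "D ! j = Cross a' b' c'' d'"
      using offj mj jj by (cases "D ! j'") auto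
    have "thru D (j, 0) = (j, 2)" "thru D (j, 1) = (j, 3)"
      by (simp_all add: thru_def N')
    then have thru: "u (j, 0) \<noteq> u (j, 2)" "u (j, 1) \<noteq> u (j, 3)"
      using u_thru[OF dartj, of 0] u_thru[OF dartj, of 1] by (auto simp: N')
    have r1: "u (r (i, 1)) \<noteq> u (i, 1)" and r2: "u (r (i, 2)) \<noteq> u (i, 2)"
      using u_rev dart by simp_all
    have "r (r (i, s)) = (i, s)"
      using reflection_involution[OF r dart] s by auto
    \<comment> \<open>The end with index \<open>s\<close> is the one sent to index 0, which
      identifies the mirror node of \<open>j\<close> as \<open>i\<close>.\<close>
    moreover have "r (i, s) = (j, 0)"
      using rj[of s] s jj by auto
    ultimately have "fst (r (j, 0)) = i"
      by simp
    moreover have "j \<in> S"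
      using j' offj mj jj by (simp add: S_def)
    moreover have "c j = - c i"
    proof -
      have "(0 + 4 - 2) mod 4 = (2::nat)" "(0 + 4 - 1) mod 4 = (3::nat)"
        "(4 div 2 + 4 - 2) mod 4 = (0::nat)" "(4 div 2 + 4 - 1) mod 4 = (1::nat)"
        by simp_all
      then have "(r (i, 1) = (j, 3) \<and> r (i, 2) = (j, 2)) \<or> (r (i, 1) = (j, 1) \<and> r (i, 2) = (j, 0))"
        using s rj[of 1] rj[of 2] unfolding jj by (elim disjE) simp_all
      \<comment> \<open>Of the two ends deciding the sign, exactly one has the same direction at
        \<open>j\<close> as at \<open>i\<close>: end 1 if \<open>s = 0\<close>, end 2 if
        \<open>s = 2\<close>.\<close>
      then have "(u (i, 1) = u (i, 2)) \<noteq> (u (j, 1) = u (j, 2))"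
        using r1 r2 thru by (elim disjE conjE) (simp_all only:, blast+)
      then show ?thesis
        by (auto simp: c_def N N')
    qed
    ultimately show ?thesis by simp
  qed
  have "(\<Sum>i\<in>S. - c i) = (\<Sum>i\<in>S. c i)"
    by (rule sum.reindex_bij_witness[where i = "\<lambda>i. fst (r (i, 0))" and j = "\<lambda>i. fst (r (i, 0))"])
      (use mate in auto)
  then have "(\<Sum>i\<in>S. c i) = 0"
    by (simp add: sum_negf)
  moreover have "(\<Sum>i\<in>S. c i) = (\<Sum>i | i < length D \<and> \<not> axis_crossing (D ! i). c i)"
  proof (rule sum.mono_neutral_left)
    show "S \<subseteq> {i. i < length D \<and> \<not> axis_crossing (D ! i)}"
    proof
      fix i assume "i \<in> S"
      then show "i \<in> {i. i < length D \<and> \<not> axis_crossing (D ! i)}"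
        by (cases "D ! i") (auto simp: S_def)
    qed
    show "\<forall>i\<in>{i. i < length D \<and> \<not> axis_crossing (D ! i)} - S. c i = 0"
    proof
      fix i assume "i \<in> {i. i < length D \<and> \<not> axis_crossing (D ! i)} - S"
      then show "c i = 0"
        by (cases "D ! i") (auto simp: S_def c_def)
    qed
  qed simp
  ultimately show ?thesis by (simp add: c_def)
qed

fun axis_sign :: "'e node \<Rightarrow> int" where
  "axis_sign (Over _ _ _ _) = 1"
| "axis_sign (Under _ _ _ _) = - 1"
| "axis_sign _ = 0"

text \<open>Since \<open>r\<close> swaps the two strands and reverses \<open>u\<close>, both strands
  cross the axis in the same horizontal direction, so only the type of the crossing decides its
  sign.\<close>

lemma axis_crossing_sign:
  fixes u :: "dart \<Rightarrow> bool"
  assumes r: "reflection D r"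
    and u_rev: "\<forall>d\<in>darts (code D). u (r d) \<noteq> u d"
    and i: "i < length D" "axis_crossing (D ! i)"
    and u_thru: "\<forall>d\<in>darts (code D). fst d = i \<longrightarrow> u (thru D d) \<noteq> u d"
  shows "crossing_sign (D ! i) (\<lambda>k. u (i, k)) = axis_sign (D ! i)"
proof -
  note u_rev = bspec[OF u_rev] and u_thru = bspec[OF u_thru, THEN mp]
  have m: "length (ends (D ! i)) = 4" and ax: "on_axis (D ! i)"
    using i by (cases "D ! i"; simp)+
  have di: "(i, k) \<in> darts (code D) \<longleftrightarrow> k < 4" for k
    using i m by (simp add: mem_darts_code)
  have "u (i, 3) \<noteq> u (i, 0)" "u (i, 2) \<noteq> u (i, 1)"
    using u_rev[of "(i, 0)"] u_rev[of "(i, 1)"] reflection_on_axis[OF r i(1) ax, unfolded m]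
    by (simp_all add: di)
  moreover have "thru D (i, 0) = (i, 2)"
    by (simp add: thru_def m)
  then have "u (i, 2) \<noteq> u (i, 0)"
    using u_thru[of "(i, 0)"] di by auto
  ultimately show ?thesis
    using i(2) by (cases "D ! i") auto
qed

section \<open>Replacing a crossing by two nodes with two ends, the common form of both
  smoothings\<close>

definition split_node :: "'e diagram \<Rightarrow> nat \<Rightarrow> 'e node \<Rightarrow> 'e node \<Rightarrow> 'e diagram" where
  "split_node D i N1 N2 = take i D @ [N1, N2] @ drop (Suc i) D"

definition shift_index :: "nat \<Rightarrow> nat \<Rightarrow> nat" where
  "shift_index i j = (if j < i then j else Suc j)"

lemma length_split_node: "i < length D \<Longrightarrow> length (split_node D i N1 N2) = Suc (length D)"
  by (simp add: split_node_def)

lemma split_node_nth: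
  assumes "i < length D"
  shows "split_node D i N1 N2 ! i = N1" "split_node D i N1 N2 ! Suc i = N2"
    "j < length D \<Longrightarrow> j \<noteq> i \<Longrightarrow> split_node D i N1 N2 ! shift_index i j = D ! j"
proof -
  show "j < length D \<Longrightarrow> j \<noteq> i \<Longrightarrow> split_node D i N1 N2 ! shift_index i j = D ! j"
  proof (cases "j < i")
    case False
    assume j: "j < length D" "j \<noteq> i"
    then obtain k where k: "j = Suc (i + k)"
      using False by (metis less_imp_Suc_add linorder_neqE_nat)
    show ?thesis
      using assms j by (simp add: split_node_def shift_index_def nth_append k)
  qed (use assms in \<open>simp add: split_node_def shift_index_def nth_append\<close>)
qed (use assms in \<open>simp_all add: split_node_def nth_append\<close>)

lemma shift_index_inj: "shift_index i j = shift_index i j' \<longleftrightarrow> j = j'"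
  by (auto simp: shift_index_def)

text \<open>Nodes with two ends have sign 0, so only the old nodes other than \<open>i\<close>
  contribute, at shifted positions. The predicate \<open>Q\<close> allows one proof for both
  writhes.\<close>

lemma split_node_sum:
  assumes i: "i < length D" and N: "length (ends N1) = 2" "length (ends N2) = 2"
  shows "(\<Sum>j | j < length (split_node D i N1 N2) \<and> Q (split_node D i N1 N2 ! j).
            crossing_sign (split_node D i N1 N2 ! j) (\<lambda>k. v (j, k))) =
         (\<Sum>j | j < length D \<and> j \<noteq> i \<and> Q (D ! j). crossing_sign (D ! j) (\<lambda>k. v (shift_index i j, k)))"
    (is "sum ?g ?T = sum ?h ?S")
proof -
  have zero: "crossing_sign N1 f = 0" "crossing_sign N2 f = 0" for f
    using N by (cases N1; simp)(cases N2; use N in simp)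
  have img: "shift_index i ` ?S = ?T - {i, Suc i}"
  proof (intro set_eqI iffI)
    fix j' assume j': "j' \<in> ?T - {i, Suc i}"
    define j where "j = (if j' < i then j' else j' - 1)"
    have j: "shift_index i j = j'" "j < length D" "j \<noteq> i"
      using j' i by (auto simp: j_def shift_index_def length_split_node)
    with j' split_node_nth(3)[OF i, of j N1 N2] show "j' \<in> shift_index i ` ?S"
      by (intro image_eqI[of _ _ j]) auto
  next
    fix j' assume "j' \<in> shift_index i ` ?S"
    then obtain j where "j' = shift_index i j" "j \<in> ?S" by blast
    with split_node_nth(3)[OF i, of j N1 N2] show "j' \<in> ?T - {i, Suc i}"
      by (auto simp: shift_index_def length_split_node[OF i] split: if_splits)
  qed
  have "sum ?g ?T = sum ?g (?T - {i, Suc i})"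
    by (rule sum.mono_neutral_right) (auto simp: split_node_nth[OF i] zero)
  also have "\<dots> = sum (?g \<circ> shift_index i) ?S"
    unfolding img[symmetric] by (rule sum.reindex) (simp add: inj_on_def shift_index_inj)
  also have "\<dots> = sum ?h ?S"
    by (rule sum.cong) (auto simp: split_node_nth[OF i])
  finally show ?thesis .
qed

text \<open>
  \<open>q\<close> gives the darts which replace the four darts at the node \<open>i\<close> when it is split in two.
\<close>

definition split_dart :: "nat \<Rightarrow> (nat \<Rightarrow> dart) \<Rightarrow> dart \<Rightarrow> dart" where
  "split_dart i q d = (if fst d = i then q (snd d) else (shift_index i (fst d), snd d))"

text \<open>The map \<open>p\<close> is injective and preserves labels, so the edge condition pulls
  back from \<open>v\<close>. It commutes with \<open>thru\<close> only away from \<open>i\<close>,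
  where the strands are not reconnected; hence the restriction in the second claim.\<close>

lemma split_node_orientation:
  fixes D :: "'e diagram" and q :: "nat \<Rightarrow> dart" and i :: nat
  defines "p \<equiv> split_dart i q"
  assumes i: "i < length D" and m: "length (ends (D ! i)) = 4"
    and N: "length (ends N1) = 2" "length (ends N2) = 2"
    and q: "inj_on q {..<4}" "\<forall>k<4. fst (q k) = i \<or> fst (q k) = Suc i"
      "\<forall>k<4. snd (q k) < 2"
      "\<forall>k<4. ends (split_node D i N1 N2 ! fst (q k)) ! snd (q k) = ends (D ! i) ! k"
    and v: "orientation (split_node D i N1 N2) v"
  shows "\<forall>d\<in>darts (code D). \<forall>d'\<in>darts (code D).
      d \<noteq> d' \<and> label (code D) d = label (code D) d' \<longrightarrow> v (p d) \<noteq> v (p d')"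
    and "\<forall>d\<in>darts (code D). fst d \<noteq> i \<longrightarrow> v (p (thru D d)) \<noteq> v (p d)"
proof -
  note q = q(1) q(2-4)[rule_format]
  let ?D = "split_node D i N1 N2"
  have p_i: "p d = q (snd d)" if "fst d = i" for d
    using that by (simp add: p_def split_dart_def)
  have p_ni: "p d = (shift_index i (fst d), snd d)" if "fst d \<noteq> i" for d
    using that by (simp add: p_def split_dart_def)
  have k4: "snd d < 4" if "d \<in> darts (code D)" "fst d = i" for d
    using that m by (simp add: mem_darts_code)
  have p: "p d \<in> darts (code ?D) \<and> label (code ?D) (p d) = label (code D) d"
    if d: "d \<in> darts (code D)" for d
  proof (cases "fst d = i")
    case True
    note k = k4[OF d True]
    have f: "fst (q (snd d)) < length ?D"
      using q(2)[OF k] i by (auto simp: length_split_node)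
    have "length (ends (?D ! fst (q (snd d)))) = 2"
      using q(2)[OF k] by (elim disjE) (simp_all only: split_node_nth[OF i] N)
    with f have "q (snd d) \<in> darts (code ?D)"
      using q(3)[OF k] by (simp add: mem_darts_code)
    moreover have "label (code ?D) (q (snd d)) = label (code D) d"
      using label_code[OF f, of "snd (q (snd d))"] label_code[OF i, of "snd d"] q(4)[OF k] True 
      by (metis prod.collapse)
    ultimately show ?thesis
      by (simp add: p_i True)
  next
    case False
    have "fst d < length D" "snd d < length (ends (D ! fst d))"
      using d by (auto simp: mem_darts_code)
    moreover have "shift_index i (fst d) < length ?D"
      using \<open>fst d < length D\<close> i by (auto simp: shift_index_def length_split_node)
    ultimately show ?thesis
      using False label_code[of "fst d" D "snd d"]
      by (simp add: p_ni mem_darts_code split_node_nth(3)[OF i] label_code)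
  qed
  have shift_ne: "shift_index i j \<noteq> i \<and> shift_index i j \<noteq> Suc i" if "j \<noteq> i" for j
    using that by (auto simp: shift_index_def)
  have inj: "d = d'" if d: "d \<in> darts (code D)" "d' \<in> darts (code D)" and eq: "p d = p d'" for d d'
  proof (cases "fst d = i"; cases "fst d' = i")
    assume "fst d = i" "fst d' = i"
    then show ?thesis
      using d eq k4[of d] k4[of d'] inj_onD[OF q(1), of "snd d" "snd d'"]
      by (simp add: p_i prod_eq_iff)
  next
    assume "fst d = i" "fst d' \<noteq> i"
    then show ?thesis
      using eq q(2)[OF k4[OF d(1)]] shift_ne[of "fst d'"] by (auto simp: p_i p_ni)
  next
    assume "fst d \<noteq> i" "fst d' = i"
    then show ?thesis
      using eq q(2)[OF k4[OF d(2)]] shift_ne[of "fst d"] by (auto simp: p_i p_ni dest: sym)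
  next
    assume "fst d \<noteq> i" "fst d' \<noteq> i"
    then show ?thesis
      using eq by (auto simp: p_ni shift_index_inj prod_eq_iff)
  qed
  show "\<forall>d\<in>darts (code D). \<forall>d'\<in>darts (code D).
      d \<noteq> d' \<and> label (code D) d = label (code D) d' \<longrightarrow> v (p d) \<noteq> v (p d')"
  proof (intro ballI impI, elim conjE)
    fix d d' assume "d \<in> darts (code D)" "d' \<in> darts (code D)" "d \<noteq> d'"
      "label (code D) d = label (code D) d'"
    then show "v (p d) \<noteq> v (p d')"
      using orientation_edge[OF v] p inj by metis
  qed
  show "\<forall>d\<in>darts (code D). fst d \<noteq> i \<longrightarrow> v (p (thru D d)) \<noteq> v (p d)"
  proof (intro ballI impI)
    fix d assume d: "d \<in> darts (code D)" "fst d \<noteq> i"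
    have "fst d < length D"
      using d by (simp add: mem_darts_code)
    then have "p (thru D d) = thru ?D (p d)"
      using d(2) by (simp add: p_ni) (simp add: thru_def Let_def split_node_nth(3)[OF i])
    then show "v (p (thru D d)) \<noteq> v (p d)"
      using orientation_thru[OF v] p[OF d(1)] by simp
  qed
qed

text \<open>The pullback \<open>u\<close> of \<open>v\<close> to \<open>D\<close> is again reversed
  by \<open>r\<close>, so both writhes of the split diagram can be evaluated on \<open>D\<close>
  from the symmetry alone. The two alternatives in \<open>vq\<close> are the strands of the
  horizontal and of the vertical smoothing.\<close>

lemma split_node_writhe:
  fixes D :: "'e diagram" and q :: "nat \<Rightarrow> dart"
  assumes r: "reflection D r" and rK: "\<forall>K\<in>components D. r ` K = K"
    and out: "orientation D out"
    and rev: "\<forall>d\<in>darts (code D). out (r d) \<noteq> out d"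
    and i: "i < length D" and ax: "axis_crossing (D ! i)"
    and N: "length (ends N1) = 2" "length (ends N2) = 2"
    and q: "inj_on q {..<4}" "\<forall>k<4. fst (q k) = i \<or> fst (q k) = Suc i"
      "\<forall>k<4. snd (q k) < 2"
      "\<forall>k<4. ends (split_node D i N1 N2 ! fst (q k)) ! snd (q k) = ends (D ! i) ! k"
    and v: "orientation (split_node D i N1 N2) v"
    and vq: "(v (q 0) \<noteq> v (q 3) \<and> v (q 1) \<noteq> v (q 2)) \<or>
      (v (q 0) \<noteq> v (q 1) \<and> v (q 2) \<noteq> v (q 3))"
  shows "off_axis_writhe (split_node D i N1 N2) v = off_axis_writhe D out"
    and "on_axis_writhe D out = on_axis_writhe (split_node D i N1 N2) v + axis_sign (D ! i)"
proof -
  define u where "u = (\<lambda>d. v (split_dart i q d))"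
  have m: "length (ends (D ! i)) = 4"
    using ax by (cases "D ! i") simp_all
  have u_ni: "u (j, k) = v (shift_index i j, k)" if "j \<noteq> i" for j k
    using that by (simp add: u_def split_dart_def)
  have u_thru: "\<forall>d\<in>darts (code D). fst d \<noteq> i \<longrightarrow> u (thru D d) \<noteq> u d"
    using split_node_orientation(2)[OF i m N q v] unfolding u_def .
  have u_i: "u (i, k) = v (q k)" for k
    by (simp add: u_def split_dart_def)
  have u_rev: "\<forall>d\<in>darts (code D). u (r d) \<noteq> u d"
    using reversed_after_smoothing[OF r rK out rev i ax _ u_thru vq[folded u_i]] 
      split_node_orientation(1)[OF i m N q v] unfolding u_def by blast
  have "off_axis_writhe D out = 0"
    unfolding off_axis_writhe_def
    by (rule off_axis_sum_zero[OF r rev]) (use orientation_thru[OF out] in auto)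
  moreover have "off_axis_writhe (split_node D i N1 N2) v = 0"
  proof -
    have "off_axis_writhe (split_node D i N1 N2) v =
        (\<Sum>j | j < length D \<and> \<not> axis_crossing (D ! j). crossing_sign (D ! j) (\<lambda>k. u (j, k)))"
      unfolding off_axis_writhe_def split_node_sum[OF i N, where Q = "\<lambda>N. \<not> axis_crossing N"]
    proof (rule sum.cong)
      fix j assume "j \<in> {j. j < length D \<and> \<not> axis_crossing (D ! j)}"
      then have "j \<noteq> i" using ax by auto
      then show "crossing_sign (D ! j) (\<lambda>k. v (shift_index i j, k)) = crossing_sign (D ! j) (\<lambda>k. u (j, k))"
        by (simp add: u_ni)
    qed (use ax in auto)
    also have "\<dots> = 0"
      by (rule off_axis_sum_zero[OF r u_rev]) (use u_thru ax in auto)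
    finally show ?thesis .
  qed
  ultimately show "off_axis_writhe (split_node D i N1 N2) v = off_axis_writhe D out"
    by simp
  have "on_axis_writhe D out = (\<Sum>j | j < length D \<and> axis_crossing (D ! j). axis_sign (D ! j))"
    unfolding on_axis_writhe_def
    by (rule sum.cong) (use axis_crossing_sign[OF r rev] orientation_thru[OF out] in auto)
  also have "{j. j < length D \<and> axis_crossing (D ! j)} =
      insert i {j. j < length D \<and> j \<noteq> i \<and> axis_crossing (D ! j)}"
    using i ax by auto
  finally have "on_axis_writhe D out =
      axis_sign (D ! i) + (\<Sum>j | j < length D \<and> j \<noteq> i \<and> axis_crossing (D ! j). axis_sign (D ! j))"
    by simp
  moreover have "on_axis_writhe (split_node D i N1 N2) v =
      (\<Sum>j | j < length D \<and> j \<noteq> i \<and> axis_crossing (D ! j). axis_sign (D ! j))"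
    unfolding on_axis_writhe_def split_node_sum[OF i N, where Q = axis_crossing]
  proof (rule sum.cong)
    fix j assume j: "j \<in> {j. j < length D \<and> j \<noteq> i \<and> axis_crossing (D ! j)}"
    then have "crossing_sign (D ! j) (\<lambda>k. u (j, k)) = axis_sign (D ! j)"
      by (intro axis_crossing_sign[OF r u_rev]) (use u_thru in auto)
    with j show "crossing_sign (D ! j) (\<lambda>k. v (shift_index i j, k)) = axis_sign (D ! j)"
      by (simp add: u_ni)
  qed simp
  ultimately show "on_axis_writhe D out = on_axis_writhe (split_node D i N1 N2) v + axis_sign (D ! i)"
    by simp
qed

lemma smoothing_writhe:
  assumes r: "reflection D r" and rK: "\<forall>K\<in>components D. r ` K = K"
    and out: "orientation D out"
    and rev: "\<forall>d\<in>darts (code D). out (r d) \<noteq> out d"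
    and i: "i < length D" and N: "D ! i = Over ul ll lr ur \<or> D ! i = Under ul ll lr ur"
    and v: "orientation D' v" and D': "D' = h_smoothing D i \<or> D' = v_smoothing D i"
  shows "off_axis_writhe D' v = off_axis_writhe D out"
    and "on_axis_writhe D out = on_axis_writhe D' v + axis_sign (D ! i)"
proof -
  have ax: "axis_crossing (D ! i)" and e: "ends (D ! i) = [ul, ll, lr, ur]"
    using N by auto
  have four: "k < 4 \<longleftrightarrow> k = 0 \<or> k = 1 \<or> k = 2 \<or> k = (3::nat)" for k
    by auto
  have set4: "{..<4} = {0, 1, 2, 3::nat}"
    by auto
  have "off_axis_writhe D' v = off_axis_writhe D out \<and>
    on_axis_writhe D out = on_axis_writhe D' v + axis_sign (D ! i)"
    using D'
  proof
    assume "D' = h_smoothing D i"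
    then have D': "D' = split_node D i (Traverse ul ur) (Traverse ll lr)"
      using N by (auto simp: h_smoothing_def split_node_def)
    have t: "v (i, 1) \<noteq> v (i, 0)" "v (Suc i, 1) \<noteq> v (Suc i, 0)"
      using orientation_thru[OF v, of "(i, 0)"] orientation_thru[OF v, of "(Suc i, 0)"] i
      by (simp_all add: D' mem_darts_code length_split_node split_node_nth thru_def)
    \<comment> \<open>The list gives the new darts of \<open>ul\<close>, \<open>ll\<close>,
      \<open>lr\<close>, \<open>ur\<close> in this order.\<close>
    define q where "q = (!) [(i, 0), (Suc i, 0), (Suc i, 1), (i, 1::nat)]"
    have q: "q 0 = (i, 0)" "q 1 = (Suc i, 0)" "q 2 = (Suc i, 1)" "q 3 = (i, 1)"
      by (simp_all add: q_def)
    show ?thesis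
      unfolding D'
      by (intro conjI split_node_writhe[OF r rK out rev i ax _ _ _ _ _ _ v[unfolded D'], where q = q])
        (use t i in \<open>auto simp: four set4 q[simplified] q e split_node_nth\<close>)
  next
    assume "D' = v_smoothing D i"
    then have D': "D' = split_node D i (Plain ul ll) (Plain ur lr)"
      using N by (auto simp: v_smoothing_def split_node_def)
    have t: "v (i, 1) \<noteq> v (i, 0)" "v (Suc i, 1) \<noteq> v (Suc i, 0)"
      using orientation_thru[OF v, of "(i, 0)"] orientation_thru[OF v, of "(Suc i, 0)"] i
      by (simp_all add: D' mem_darts_code length_split_node split_node_nth thru_def)
    \<comment> \<open>As before; \<open>Plain ur lr\<close> names \<open>ur\<close> first, so
      \<open>lr\<close> is its end 1.\<close>
    define q where "q = (!) [(i, 0), (i, 1), (Suc i, 1), (Suc i, 0::nat)]"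
    have q: "q 0 = (i, 0)" "q 1 = (i, 1)" "q 2 = (Suc i, 1)" "q 3 = (Suc i, 0)"
      by (simp_all add: q_def)
    show ?thesis
      unfolding D'
      by (intro conjI split_node_writhe[OF r rK out rev i ax _ _ _ _ _ _ v[unfolded D'], where q = q])
        (use t i in \<open>auto simp: four set4 q[simplified] q e split_node_nth\<close>)
  qed
  then show "off_axis_writhe D' v = off_axis_writhe D out"
    "on_axis_writhe D out = on_axis_writhe D' v + axis_sign (D ! i)"
    by simp_all
qed


section \<open>Skein relation on the axis\<close>

text \<open>Earlier nodes act linearly on the evaluation of the rest, so a crossing in the middle of
  the list may be smoothed first.\<close>

lemma bracket_from_over:
  "bracket_from C (xs @ Over ul ll lr ur # ys) =
     varB * bracket_from C (xs @ h_node (Over ul ll lr ur) @ ys) +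
     inverse varB * bracket_from C (xs @ v_node (Over ul ll lr ur) @ ys)"
proof (induction xs arbitrary: C)
  case (Cons N xs)
  then show ?case by (cases N) (simp_all add: algebra_simps)
qed simp

lemma bracket_from_under:
  "bracket_from C (xs @ Under ul ll lr ur # ys) =
     inverse varB * bracket_from C (xs @ h_node (Under ul ll lr ur) @ ys) +
     varB * bracket_from C (xs @ v_node (Under ul ll lr ur) @ ys)"
proof (induction xs arbitrary: C)
  case (Cons N xs)
  then show ?case by (cases N) (simp_all add: algebra_simps)
qed simp

lemma bracket_over:
  assumes "i < length D" "D ! i = Over ul ll lr ur"
  shows "bracket D = varB * bracket (h_smoothing D i) + inverse varB * bracket (v_smoothing D i)"
  using bracket_from_over[of "[]" "take i D" ul ll lr ur "drop (Suc i) D"] id_take_nth_drop[OF assms(1)]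
  by (simp add: bracket_def h_smoothing_def v_smoothing_def assms(2))

lemma bracket_under:
  assumes "i < length D" "D ! i = Under ul ll lr ur"
  shows "bracket D = inverse varB * bracket (h_smoothing D i) + varB * bracket (v_smoothing D i)"
  using bracket_from_under[of "[]" "take i D" ul ll lr ur "drop (Suc i) D"] id_take_nth_drop[OF assms(1)]
  by (simp add: bracket_def h_smoothing_def v_smoothing_def assms(2))

lemma varA_nonzero: "varA \<noteq> 0" and varB_nonzero: "varB \<noteq> 0"
  by (simp_all add: varA_def varB_def Zero_fract_def eq_fract)

text \<open>Vanishing would give \<open>A^4 + 1 = 0\<close> for an indeterminate. This permits
  division by the circle value when negative exponents occur.\<close>

lemma circle_value_nonzero: "- (varA ^ 2) - inverse (varA ^ 2) \<noteq> 0"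
proof
  assume "- (varA ^ 2) - inverse (varA ^ 2) = 0"
  then have "varA ^ 4 + 1 = 0"
    using varA_nonzero by (simp add: field_simps power2_eq_square power4_eq_xxxx)
  then show False
    by (simp add: varA_def Zero_fract_def One_fract_def eq_fract power4_eq_xxxx one_pCons)
qed

text \<open>The sign lost by smoothing contributes \<open>-B^(-3)\<close> for \<open>Over\<close>
  and \<open>-B^3\<close> for \<open>Under\<close>; multiplied with the bracket coefficients
  \<open>B\<close> and \<open>B^(-1)\<close> in the respective order, this gives the powers of
  \<open>sqrt_s = B^(-2)\<close>.\<close>

lemma W_skein:
  assumes r: "reflection D r" and rK: "\<forall>K\<in>components D. r ` K = K"
    and out: "orientation D out"
    and rev: "\<forall>d\<in>darts (code D). out (r d) \<noteq> out d"
    and i: "i < length D"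
    and out_h: "orientation (h_smoothing D i) out_h" and out_v: "orientation (v_smoothing D i) out_v"
  shows "D ! i = Over ul ll lr ur \<Longrightarrow> W D out = - sqrt_s * W (h_smoothing D i) out_h
                        - sqrt_s ^ 2 * W (v_smoothing D i) out_v"
    and "D ! i = Under ul ll lr ur \<Longrightarrow> W D out = - inverse sqrt_s * W (h_smoothing D i) out_h
                        - inverse (sqrt_s ^ 2) * W (v_smoothing D i) out_v"
proof -
  have nz: "- inverse (varB ^ 3) \<noteq> 0"
    using varB_nonzero by simp
  note writhe = smoothing_writhe[OF r rK out rev i]
  have B: "sqrt_s = inverse varB * inverse varB"
    by (simp add: sqrt_s_def power2_eq_square)
  {
    assume N: "D ! i = Over ul ll lr ur"
    then have N': "D ! i = Over ul ll lr ur \<or> D ! i = Under ul ll lr ur" by simp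
    note w = writhe[OF N' out_h disjI1[OF refl]] writhe[OF N' out_v disjI2[OF refl]]
    define b where "b = on_axis_writhe (v_smoothing D i) out_v"
    have bh: "on_axis_writhe (h_smoothing D i) out_h = b" and b: "on_axis_writhe D out = b + 1"
      using w(2,4) N by (simp_all add: b_def)
    show "W D out = - sqrt_s * W (h_smoothing D i) out_h - sqrt_s ^ 2 * W (v_smoothing D i) out_v"
      unfolding W_def bracket_over[OF i N] w(1,3) b bh b_def[symmetric] power_int_add_1[OF disjI1[OF nz]] B
      using varB_nonzero by (simp add: field_simps power2_eq_square power3_eq_cube)
  next
    assume N: "D ! i = Under ul ll lr ur"
    then have N': "D ! i = Over ul ll lr ur \<or> D ! i = Under ul ll lr ur" by simp
    note w = writhe[OF N' out_h disjI1[OF refl]] writhe[OF N' out_v disjI2[OF refl]]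
    \<comment> \<open>The crossing is negative, so now \<open>D\<close> has the smaller on-axis
      writhe and serves as the base exponent.\<close>
    define b where "b = on_axis_writhe D out"
    have bh: "on_axis_writhe (h_smoothing D i) out_h = b + 1"
      and bv: "on_axis_writhe (v_smoothing D i) out_v = b + 1"
      using w(2,4) N by (simp_all add: b_def)
    show "W D out = - inverse sqrt_s * W (h_smoothing D i) out_h
      - inverse (sqrt_s ^ 2) * W (v_smoothing D i) out_v"
      unfolding W_def bracket_under[OF i N] w(1,3) bv bh b_def[symmetric] power_int_add_1[OF disjI1[OF nz]] B
      using varB_nonzero by (simp add: field_simps power2_eq_square power3_eq_cube)
  }
qed


section \<open>Points of a component on the axis\<close>

text \<open>
  On the cycle \<open>X\<close> of length \<open>n\<close> the map \<open>a\<close> is a reflection $k \mapsto c - k$ and \<open>a \<circ> p\<close> is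
  $k \mapsto c - 1 - k$.  The latter is free of fixed points only if \<open>n\<close> and \<open>c\<close> are even, and then
  $2k \equiv c$ has exactly two solutions modulo \<open>n\<close>.
\<close>

lemma dihedral_two_fixed_points:
  fixes p a :: "'a \<Rightarrow> 'a"
  assumes X: "X = range (\<lambda>k. (p ^^ k) x0)" and fin: "finite X" and inj: "inj_on p X"
    and a: "\<And>x. x \<in> X \<Longrightarrow> a x \<in> X" and pap: "\<And>x. x \<in> X \<Longrightarrow> p (a (p x)) = a x"
    and free: "\<And>x. x \<in> X \<Longrightarrow> a (p x) \<noteq> x"
  shows "card {x \<in> X. a x = x} = 2"
proof -
  have mem: "(p ^^ k) x0 \<in> X" for k
    by (auto simp: X)
  have p: "p x \<in> X" if "x \<in> X" for x
  proof -
    from that obtain k where "x = (p ^^ k) x0" by (auto simp: X)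
    then have "p x = (p ^^ Suc k) x0" by simp
    then show ?thesis using mem by metis
  qed
  have pk: "(p ^^ k) x \<in> X" if "x \<in> X" for k x
    using that by (induction k) (auto intro: p)
  have cancel: "(p ^^ k) x = (p ^^ k) y \<longleftrightarrow> x = y" if "x \<in> X" "y \<in> X" for k x y
    by (induction k) (use that pk inj in \<open>auto dest: inj_onD\<close>)
  have add: "(p ^^ j) ((p ^^ k) x) = (p ^^ (j + k)) x" for j k x
    by (simp add: funpow_add)
  have cancel_less: "(p ^^ (k - j)) x0 = x0" if "(p ^^ j) x0 = (p ^^ k) x0" "j < k" for j k
    using that cancel[of "(p ^^ (k - j)) x0" x0 j] mem[of 0] mem[of "k - j"] by (simp add: add)
  obtain j k where "(p ^^ j) x0 = (p ^^ k) x0" "j < k"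
  proof -
    have "\<not> inj (\<lambda>k. (p ^^ k) x0)"
      using fin finite_imageD[of "\<lambda>k. (p ^^ k) x0" UNIV] by (auto simp: X)
    then show ?thesis
      using that unfolding inj_def by (metis linorder_neqE_nat)
  qed
  then have ex: "\<exists>n. 0 < n \<and> (p ^^ n) x0 = x0"
    using cancel_less by (metis zero_less_diff)
  define n where "n = (LEAST n. 0 < n \<and> (p ^^ n) x0 = x0)"
  have n: "0 < n" "(p ^^ n) x0 = x0"
    using LeastI_ex[OF ex] by (simp_all add: n_def)
  have n_le: "n \<le> k" if "0 < k" "(p ^^ k) x0 = x0" for k
    unfolding n_def by (rule Least_le) (use that in simp)
  have less: "\<not> (p ^^ j) x0 = (p ^^ k) x0" if "j < k" "k < n" for j k
    using n_le[of "k - j"] cancel_less[of j k] that by auto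
  have period: "(p ^^ j) x0 = (p ^^ k) x0 \<longleftrightarrow> j mod n = k mod n" for j k
  proof -
    have "(p ^^ (j mod n)) x0 = (p ^^ (k mod n)) x0 \<longleftrightarrow> j mod n = k mod n"
      using less[of "j mod n" "k mod n"] less[of "k mod n" "j mod n"] n(1)
      by (metis linorder_neqE_nat mod_less_divisor)
    then show ?thesis
      by (simp add: funpow_mod_eq[OF n(2)])
  qed
  obtain c where c: "a x0 = (p ^^ c) x0"
    using a[OF mem[of 0]] by (auto simp: X)
  \<comment> \<open>This is the rule that \<open>a\<close> sends \<open>k\<close> to
    \<open>c - k\<close>, written without subtraction; it comes from iterating
    \<open>pap\<close>.\<close>
  have conj: "(p ^^ k) (a ((p ^^ k) x0)) = (p ^^ c) x0" for k
  proof (induction k)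
    case (Suc k)
    have "(p ^^ Suc k) (a ((p ^^ Suc k) x0)) = (p ^^ k) (p (a (p ((p ^^ k) x0))))"
      by (simp add: funpow_swap1)
    with Suc pap[OF mem] show ?case by simp
  qed (simp add: c)
  have fixed: "a ((p ^^ k) x0) = (p ^^ k) x0 \<longleftrightarrow> c mod n = (2 * k) mod n" for k
  proof -
    have "a ((p ^^ k) x0) = (p ^^ k) x0 \<longleftrightarrow> (p ^^ c) x0 = (p ^^ (k + k)) x0"
      using cancel[OF a[OF mem] mem, of k k k] by (simp only: conj add)
    then show ?thesis
      by (simp only: period mult_2)
  qed
  \<comment> \<open>A solution of this congruence would make \<open>p^k x0\<close> a fixed point of
    \<open>a \<circ> p\<close>.\<close>
  have not_odd: "c mod n \<noteq> (2 * k + 1) mod n" for k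
  proof
    assume "c mod n = (2 * k + 1) mod n"
    then have "(p ^^ Suc k) (a ((p ^^ Suc k) x0)) = (p ^^ (Suc k + k)) x0"
      unfolding conj by (simp add: period mult_2 del: funpow.simps)
    then have "a ((p ^^ Suc k) x0) = (p ^^ k) x0"
      using cancel[OF a[OF mem] mem] by (simp only: add[symmetric])
    with free[OF mem[of k]] show False by simp
  qed
  have "even c"
    using not_odd[of "c div 2"] by (metis odd_two_times_div_two_succ)
  then obtain h where h: "c = 2 * h" by blast
  have "even n"
  proof (rule ccontr)
    assume "odd n"
    with \<open>even c\<close> have "odd (c + n)" by simp
    then show False
      \<comment> \<open>For odd \<open>n\<close>, the number \<open>c + n\<close> is an odd
        representative of the residue of \<open>c\<close>.\<close>
      using not_odd[of "(c + n) div 2"] by (metis odd_two_times_div_two_succ mod_add_self2)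
  qed
  then obtain m where m: "n = 2 * m" by blast
  then have "m > 0" using n by simp
  \<comment> \<open>Halving \<open>2 * k = 2 * h\<close> modulo \<open>2 * m\<close> leaves
    \<open>k = h\<close> modulo \<open>m\<close>, whose two lifts modulo \<open>n\<close> are
    \<open>z\<close> and \<open>z + m\<close>.\<close>
  define z where "z = h mod m"
  have "z < m" using \<open>m > 0\<close> by (simp add: z_def)
  have fixed': "a ((p ^^ k) x0) = (p ^^ k) x0 \<longleftrightarrow> k mod n = z \<or> k mod n = z + m" for k
  proof -
    have "a ((p ^^ k) x0) = (p ^^ k) x0 \<longleftrightarrow> k mod m = z"
      unfolding fixed h m mod_mult_mult1 z_def by auto
    also have "\<dots> \<longleftrightarrow> k mod n = z \<or> k mod n = z + m"
    proof
      show "k mod m = z \<Longrightarrow> k mod n = z \<or> k mod n = z + m"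
        unfolding m using mod_double_nat[of k m] by auto
      have "k mod m = (k mod n) mod m"
        unfolding m by (simp add: mod_mod_cancel)
      then show "k mod n = z \<or> k mod n = z + m \<Longrightarrow> k mod m = z"
        using \<open>z < m\<close> by auto
    qed
    finally show ?thesis .
  qed
  have zn: "z mod n = z" "(z + m) mod n = z + m"
    using \<open>z < m\<close> by (simp_all add: m)
  have "{x \<in> X. a x = x} = {(p ^^ z) x0, (p ^^ (z + m)) x0}"
  proof (intro set_eqI iffI)
    fix x assume "x \<in> {x \<in> X. a x = x}"
    then obtain k where k: "x = (p ^^ k) x0" "k mod n = z \<or> k mod n = z + m"
      using fixed' by (auto simp: X)
    then show "x \<in> {(p ^^ z) x0, (p ^^ (z + m)) x0}"
      using period[of k z] period[of k "z + m"] zn by auto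
  next
    fix x assume "x \<in> {(p ^^ z) x0, (p ^^ (z + m)) x0}"
    then show "x \<in> {x \<in> X. a x = x}"
      using fixed'[of z] fixed'[of "z + m"] zn mem by auto
  qed
  moreover have "(p ^^ z) x0 \<noteq> (p ^^ (z + m)) x0"
    unfolding period zn using \<open>m > 0\<close> by simp
  ultimately show ?thesis by simp
qed

section \<open>The involution exchanging the two ends of an edge\<close>

definition mate :: "'e diagram \<Rightarrow> dart \<Rightarrow> dart" where
  "mate D d = (THE d'. d' \<in> darts (code D) \<and> d' \<noteq> d \<and> label (code D) d' = label (code D) d)"

lemma mate_unique_ex:
  assumes "paired (code D)" "d \<in> darts (code D)"
  shows "\<exists>!d'. d' \<in> darts (code D) \<and> d' \<noteq> d \<and> label (code D) d' = label (code D) d"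
proof -
  define S where "S = {d' \<in> darts (code D). label (code D) d' = label (code D) d}"
  have "card S = 2"
    using assms unfolding paired_def S_def by blast
  then obtain x y where S: "S = {x, y}" "x \<noteq> y"
    by (auto simp: card_2_iff)
  have "d \<in> S"
    using assms(2) by (simp add: S_def)
  with S have "\<exists>!d'. d' \<in> S \<and> d' \<noteq> d"
    by auto
  moreover have "d' \<in> S \<and> d' \<noteq> d \<longleftrightarrow>
      d' \<in> darts (code D) \<and> d' \<noteq> d \<and> label (code D) d' = label (code D) d" for d'
    unfolding S_def by blast
  ultimately show ?thesis by (simp only:)
qed

lemma mate:
  assumes "paired (code D)" "d \<in> darts (code D)"
  shows "mate D d \<in> darts (code D)" "mate D d \<noteq> d" "label (code D) (mate D d) = label (code D) d"
  using theI'[OF mate_unique_ex[OF assms]] unfolding mate_def by blast+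

lemma mate_eqI:
  assumes "paired (code D)" "d \<in> darts (code D)" "d' \<in> darts (code D)" "d' \<noteq> d"
    "label (code D) d' = label (code D) d"
  shows "mate D d = d'"
  using mate_unique_ex[OF assms(1,2)] mate[OF assms(1,2)] assms by blast

lemma mate_mate:
  assumes "paired (code D)" "d \<in> darts (code D)"
  shows "mate D (mate D d) = d"
  using assms mate[OF assms] by (intro mate_eqI) auto

text \<open>As \<open>r\<close> is injective and respects edges, the two ends of an edge go to two
  distinct darts with a common label.\<close>

lemma reflection_mate:
  assumes r: "reflection D r" and D: "paired (code D)" and d: "d \<in> darts (code D)"
  shows "r (mate D d) = mate D (r d)"
proof -
  note m = mate[OF D d]
  have "r (mate D d) \<noteq> r d"
    using reflection_involution[OF r] d m by metis
  then show ?thesis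
    using mate_eqI[OF D reflection_in_darts[OF r d] reflection_in_darts[OF r m(1)]]
      reflection_label[OF r m(1) d m(3)] by simp
qed

lemma component_thru:
  assumes "K \<in> components D" "d \<in> K"
  shows "thru D d \<in> K"
proof -
  have "d \<in> darts (code D)" using component_subset assms by blast
  then have "(d, thru D d) \<in> strand_step D"
    by (simp add: strand_step_def thru_in_darts)
  then show ?thesis using component_closed[OF assms] by blast
qed

lemma component_mate:
  assumes "paired (code D)" "K \<in> components D" "d \<in> K"
  shows "mate D d \<in> K"
proof -
  have d: "d \<in> darts (code D)" using component_subset assms by blast
  then have "(d, mate D d) \<in> strand_step D"
    using mate[OF assms(1) d] unfolding strand_step_def by auto
  then show ?thesis using component_closed[OF assms(2,3)] by blast
qed

definition axis_points :: "'e diagram \<Rightarrow> nat set" where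
  "axis_points D = {i. i < length D \<and> on_axis (D ! i) \<and> \<not> axis_crossing (D ! i)}"

text \<open>
  The outgoing darts of a component form a cycle under \<open>p\<close> (run along the edge and through the next
  node), and \<open>a = thru \<circ> r\<close> is a reflection of this cycle.  Its fixed points are the points on the
  axis, whereas \<open>a \<circ> p = r \<circ> mate\<close> has none because \<open>r\<close> interchanges the half-planes.
\<close>

lemma component_axis_points:
  assumes r: "reflection D r" and D: "paired (code D)" and out: "orientation D out"
    and rev: "\<forall>d\<in>darts (code D). out (r d) \<noteq> out d"
    and K: "K \<in> components D" and rK: "r ` K = K"
  shows "card {d \<in> K. out d \<and> fst d \<in> axis_points D} = 2"
proof -
  define p where "p d = thru D (mate D d)" for d
  define a where "a d = thru D (r d)" for d
  define X where "X = {d \<in> K. out d}"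
  note Kd = component_subset[OF K, THEN subsetD]
  note Kt = component_thru[OF K] and Km = component_mate[OF D K]
  have Kr: "r d \<in> K" if "d \<in> K" for d
    using rK that by blast
  have tt: "thru D (thru D d) = d" and mm: "mate D (mate D d) = d" and rr: "r (r d) = d"
    and rt: "r (thru D d) = thru D (r d)" and rm: "r (mate D d) = mate D (r d)"
    if "d \<in> K" for d
    using Kd[OF that] by (rule thru_thru mate_mate[OF D] reflection_involution[OF r]
      reflection_thru[OF r] reflection_mate[OF r D])+
  have out_t: "out (thru D d) = (\<not> out d)" and out_m: "out (mate D d) = (\<not> out d)"
    and out_r: "out (r d) = (\<not> out d)" if "d \<in> K" for d
  proof -
    show "out (thru D d) = (\<not> out d)"
      using orientation_thru[OF out Kd[OF that]] by simp
    show "out (r d) = (\<not> out d)"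
      using rev Kd[OF that] by blast
    show "out (mate D d) = (\<not> out d)"
      using orientation_edge[OF out] mate[OF D Kd[OF that]] Kd[OF that] by metis
  qed
  have fin: "finite K"
    using finite_subset[OF component_subset[OF K] finite_darts] .
  have "K \<noteq> {}"
    using K unfolding components_alt by (auto elim!: quotientE)
  then obtain d where "d \<in> K" by blast
  then obtain x0 where x0: "x0 \<in> X"
    using Km[of d] out_m[of d] by (cases "out d") (auto simp: X_def)
  have pX: "p x \<in> X" if "x \<in> X" for x
    using that Kt Km out_t out_m by (simp add: X_def p_def)
  have p_inv: "mate D (thru D (p x)) = x" if "x \<in> X" for x
    using that tt mm Km by (simp add: X_def p_def)
  have inj: "inj_on p X"
    by (rule inj_on_inverseI) (rule p_inv)
  define Y where "Y = range (\<lambda>k. (p ^^ k) x0)"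
  have YX: "Y \<subseteq> X"
  proof -
    have "(p ^^ k) x0 \<in> X" for k
      by (induction k) (use x0 pX in auto)
    then show ?thesis by (auto simp: Y_def)
  qed
  have pY: "p ` Y \<subseteq> Y"
  proof
    fix y assume "y \<in> p ` Y"
    then obtain k where "y = (p ^^ Suc k) x0" by (auto simp: Y_def)
    then show "y \<in> Y" unfolding Y_def by blast
  qed
  have finX: "finite X"
    using fin by (simp add: X_def)
  then have finY: "finite Y"
    using YX by (rule rev_finite_subset)
  have surj: "p ` Y = Y"
    using endo_inj_surj[OF finY pY inj_on_subset[OF inj YX]] .
  \<comment> \<open>The orbit \<open>Y\<close> is shown to exhaust \<open>X\<close>: along any
    strand path from \<open>x0\<close>, the outgoing dart of the current edge stays in
    \<open>Y\<close>. Steps against the orientation use the surjectivity of \<open>p\<close> on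
    \<open>Y\<close>.\<close>
  have "y \<in> K \<and> (if out y then y \<in> Y else mate D y \<in> Y)" if "(x0, y) \<in> (strand_step D)\<^sup>*" for y
    using that
  proof (induction rule: rtrancl_induct)
    case base
    have "x0 \<in> Y" unfolding Y_def by (rule range_eqI[of _ _ 0]) simp
    with x0 show ?case by (simp add: X_def)
  next
    case (step y z)
    then have yK: "y \<in> K" by simp
    from step(2) have "z = y \<or> z = mate D y \<or> z = thru D y"
      using mate_eqI[OF D, of y z] unfolding strand_step_def by auto
    then consider "z = y" | "z = mate D y" | "z = thru D y" by blast
    then show ?case
    proof cases
      case 1
      with step show ?thesis by simp
    next
      case 2
      with step yK Km mm out_m show ?thesis by auto
    next
      case 3
      show ?thesis
      proof (cases "out y")
        case True
        with step surj obtain w where w: "w \<in> Y" "y = p w" by force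
        then have "mate D z = w"
          using p_inv YX 3 by blast
        with w 3 True yK Kt out_t show ?thesis by simp
      next
        case False
        with step have "mate D y \<in> Y" by simp
        then have "p (mate D y) \<in> Y" using pY by blast
        then show ?thesis
          using 3 False yK Kt out_t mm by (simp add: p_def)
      qed
    qed
  qed
  then have XY: "X = Y"
    using YX component_connected[OF K, of x0] x0 by (auto simp: X_def)
  have "card {x \<in> X. a x = x} = 2"
  proof (rule dihedral_two_fixed_points[where p = p])
    show "X = range (\<lambda>k. (p ^^ k) x0)" using XY by (simp add: Y_def)
    show "finite X" by (rule finX)
    show "inj_on p X" by (rule inj)
    show "a x \<in> X" if "x \<in> X" for x
      using that Kt Kr out_t out_r by (simp add: X_def a_def)
    \<comment> \<open>Since \<open>r\<close> commutes with the involutions \<open>thru\<close> and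
      \<open>mate\<close>, all factors but \<open>thru D (r x)\<close> cancel.\<close>
    show "p (a (p x)) = a x" if "x \<in> X" for x
      using that Kt Kr Km tt mm rt rm by (simp add: X_def a_def p_def)
    show "a (p x) \<noteq> x" if "x \<in> X" for x
    proof
      assume eq: "a (p x) = x"
      have x: "x \<in> K" using that by (simp add: X_def)
      have "a (p x) = r (mate D x)"
        using x Kt Kr Km tt rt by (simp add: a_def p_def)
      with eq have "mate D x = r x"
        using rr Km x by metis
      with mate(3)[OF D Kd[OF x]] reflection_label_neq[OF r Kd[OF x]] show False
        by simp
    qed
  qed
  also have "{x \<in> X. a x = x} = {d \<in> K. out d \<and> fst d \<in> axis_points D}"
  proof -
    have "a x = x \<longleftrightarrow> fst x \<in> axis_points D" if "x \<in> K" for x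
    proof -
      have "a x = x \<longleftrightarrow> r x = thru D x"
        using that tt Kr by (metis a_def)
      also have "\<dots> \<longleftrightarrow> fst x \<in> axis_points D"
        using reflection_eq_thru_iff[OF r Kd[OF that]] Kd[OF that]
        by (simp add: axis_points_def mem_darts_code)
      finally show ?thesis .
    qed
    then show ?thesis by (auto simp: X_def)
  qed
  finally show ?thesis .
qed

section \<open>Counting the points on the axis\<close>

lemma finite_components: "finite (components D)"
  unfolding components_alt quotient_def by (simp add: finite_darts)

lemma components_disjoint:
  "K \<in> components D \<Longrightarrow> K' \<in> components D \<Longrightarrow> x \<in> K \<Longrightarrow> x \<in> K' \<Longrightarrow> K = K'"
  using component_connected component_closed by (metis subsetI subset_antisym)

text \<open>Double counting of the outgoing darts at axis points: each point has one and each
  component has two.\<close>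

lemma card_axis_points:
  assumes r: "reflection D r" and D: "paired (code D)" and out: "orientation D out"
    and rev: "\<forall>d\<in>darts (code D). out (r d) \<noteq> out d"
    and rK: "\<forall>K\<in>components D. r ` K = K"
  shows "card (axis_points D) = 2 * card (components D)"
proof -
  define F where "F = {d \<in> darts (code D). out d \<and> fst d \<in> axis_points D}"
  have two: "(i, k) \<in> darts (code D) \<longleftrightarrow> k = 0 \<or> k = 1" and t: "out (i, 1) \<longleftrightarrow> \<not> out (i, 0)"
    if i: "i \<in> axis_points D" for i k
  proof -
    obtain l r where N: "D ! i = Traverse l r"
      using i by (cases "D ! i") (auto simp: axis_points_def)
    show two: "(i, k) \<in> darts (code D) \<longleftrightarrow> k = 0 \<or> k = 1" for k
      using i N by (auto simp: axis_points_def mem_darts_code)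
    have "thru D (i, 0) = (i, 1)"
      by (simp add: thru_def N)
    then show "out (i, 1) \<longleftrightarrow> \<not> out (i, 0)"
      using orientation_thru[OF out, of "(i, 0)"] two[of 0] by auto
  qed
  have "bij_betw fst F (axis_points D)"
  proof (rule bij_betwI')
    fix x y assume "x \<in> F" "y \<in> F"
    then show "fst x = fst y \<longleftrightarrow> x = y"
      using two t by (cases x; cases y) (auto simp: F_def)
  next
    fix i assume i: "i \<in> axis_points D"
    show "\<exists>x\<in>F. i = fst x"
    proof (cases "out (i, 0)")
      case True
      with i two show ?thesis by (intro bexI[of _ "(i, 0)"]) (auto simp: F_def)
    next
      case False
      with i two t show ?thesis by (intro bexI[of _ "(i, 1)"]) (auto simp: F_def)
    qed
  qed (simp add: F_def)
  then have "card (axis_points D) = card F"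
    by (simp add: bij_betw_same_card)
  also have "F = (\<Union>K\<in>components D. {d \<in> K. out d \<and> fst d \<in> axis_points D})"
    using component_subset[of _ D] by (auto simp: F_def elim: obtain_component)
  also have "card \<dots> = (\<Sum>K\<in>components D. card {d \<in> K. out d \<and> fst d \<in> axis_points D})"
  proof (rule card_UN_disjoint)
    show "\<forall>K\<in>components D. finite {d \<in> K. out d \<and> fst d \<in> axis_points D}"
      by (intro ballI finite_subset[OF _ finite_darts[of "code D"]]) (use component_subset[of _ D] in auto)
    show "\<forall>K\<in>components D. \<forall>K'\<in>components D. K \<noteq> K' \<longrightarrow>
      {d \<in> K. out d \<and> fst d \<in> axis_points D} \<inter> {d \<in> K'. out d \<and> fst d \<in> axis_points D} = {}"
      using components_disjoint by blast
  qed (rule finite_components)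
  also have "\<dots> = (\<Sum>K\<in>components D. 2)"
    by (rule sum.cong) (use component_axis_points[OF r D out rev] rK in auto)
  finally show ?thesis by simp
qed


section \<open>Comparison with the Jones polynomial\<close>

lemma ends_forget_axis: "\<not> axis_crossing N \<Longrightarrow> ends (forget_axis N) = ends N"
  by (cases N) auto

text \<open>Without axis crossings, forgetting the axis only turns \<open>Traverse\<close> into
  \<open>Plain\<close>, which keeps all ends.\<close>

lemma components_forget_axis:
  assumes "\<forall>N\<in>set C. \<not> axis_crossing N"
  shows "components (map forget_axis C) = components C"
proof -
  have code: "code (map forget_axis C) = code C"
    using assms by (simp add: code_def ends_forget_axis)
  have "thru (map forget_axis C) d = thru C d" if "d \<in> darts (code C)" for d
    using that assms by (simp add: mem_darts_code thru_def ends_forget_axis)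
  then have "strand_step (map forget_axis C) = strand_step C"
    unfolding strand_step_def code by auto
  then show ?thesis
    unfolding components_alt code by simp
qed

lemma card_components_pos:
  assumes "C \<noteq> []"
  shows "card (components C) > 0"
proof -
  have "(0, 0) \<in> darts (code C)"
    using assms length_ends[of "C ! 0"] by (auto simp: mem_darts_code)
  then have "components C \<noteq> {}"
    by (auto elim: obtain_component)
  then show ?thesis
    by (simp add: card_gt_0_iff finite_components)
qed

text \<open>The quotient in the theorem is the ratio of the two circle values, whose signs
  cancel.\<close>

lemma sqrt_quotient:
  "(sqrt_s + inverse sqrt_s) / (sqrt_t + inverse sqrt_t) =
    (- (varB ^ 2) - inverse (varB ^ 2)) / (- (varA ^ 2) - inverse (varA ^ 2))"
proof -
  have neg: "- x - y = - (y + x)" and quot: "- x / - y = x / y" for x y :: ZAB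
    by simp_all
  show ?thesis
    unfolding neg quot by (simp add: sqrt_s_def sqrt_t_def)
qed

text \<open>Here \<open>n\<close> is half the number of axis points, not the number of circles in
  the state. With circle values \<open>a\<close>, \<open>b\<close> and \<open>N\<close> circles,
  \<open>a^(N-n) b^(n-1) = (b/a)^(n-1) a^(N-1)\<close>.\<close>

lemma circles_value_forget_axis:
  assumes C: "C \<noteq> []" "\<forall>N\<in>set C. \<not> axis_crossing N"
    and n: "length (filter on_axis C) = 2 * n" "0 < n"
  shows "circles_value C = ((sqrt_s + inverse sqrt_s) / (sqrt_t + inverse sqrt_t)) ^ (n - 1) *
    (- (varA ^ 2) - inverse (varA ^ 2)) ^ (card (components (map forget_axis C)) - 1)"
proof -
  define a b where "a = - (varA ^ 2) - inverse (varA ^ 2)" and "b = - (varB ^ 2) - inverse (varB ^ 2)"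
  have a: "a \<noteq> 0"
    using circle_value_nonzero by (simp add: a_def)
  obtain k where k: "card (components C) = Suc k"
    using card_components_pos[OF C(1)] by (metis Suc_pred)
  obtain m where m: "n = Suc m"
    using n(2) by (metis Suc_pred)
  have "circles_value C = a powi (int k - int m) * b powi int m"
    unfolding circles_value_def Let_def a_def b_def n(1) k m by simp
  also have "\<dots> = (b / a) ^ m * a ^ k"
    using a by (simp add: power_int_diff power_divide)
  finally show ?thesis
    unfolding components_forget_axis[OF C(2)] sqrt_quotient k m a_def b_def by simp
qed

text \<open>Smoothing off the axis only adds \<open>Plain\<close> nodes, so all states meet the axis
  equally often and share one prefactor.\<close>

lemma bracket_from_forget_axis:
  assumes "C @ D \<noteq> []" "\<forall>N\<in>set (C @ D). \<not> axis_crossing N"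
    and "length (filter on_axis (C @ D)) = 2 * n" "0 < n"
  shows "bracket_from C D = ((sqrt_s + inverse sqrt_s) / (sqrt_t + inverse sqrt_t)) ^ (n - 1) *
    kauffman_from (map forget_axis C) (map forget_axis D)"
  using assms
proof (induction D arbitrary: C)
  case Nil
  then show ?case
    using circles_value_forget_axis[of C n] by simp
next
  case (Cons N D)
  show ?case
  proof (cases N)
    case (Cross a b c d)
    with Cons show ?thesis
      using Cons.IH[of "C @ [Plain a b, Plain c d]"] Cons.IH[of "C @ [Plain a d, Plain b c]"]
      by (simp add: algebra_simps)
  next
    case (Traverse l r)
    with Cons show ?thesis
      using Cons.IH[of "C @ [N]"] by simp
  next
    case (Plain a b)
    with Cons show ?thesis
      using Cons.IH[of "C @ [N]"] by simp
  qed (use Cons.prems in auto)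
qed

text \<open>The on-axis writhe vanishes, so \<open>W\<close> and \<open>jones\<close> carry the same
  writhe factor and only the brackets have to be compared.\<close>

lemma W_off_axis:
  assumes D: "D \<noteq> []" "\<forall>N\<in>set D. \<not> axis_crossing N" and n: "card (axis_points D) = 2 * n" "0 < n"
  shows "W D out = ((sqrt_s + inverse sqrt_s) / (sqrt_t + inverse sqrt_t)) ^ (n - 1) * jones D out"
proof -
  have "axis_points D = {i. i < length D \<and> on_axis (D ! i)}"
    using D(2) by (auto simp: axis_points_def)
  then have "length (filter on_axis D) = 2 * n"
    using n(1) by (simp add: length_filter_conv_card)
  with D n(2) have "bracket D =
      ((sqrt_s + inverse sqrt_s) / (sqrt_t + inverse sqrt_t)) ^ (n - 1) * kauffman_from [] (map forget_axis D)"
    unfolding bracket_def using bracket_from_forget_axis[of "[]" D n] by simp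
  moreover have "on_axis_writhe D out = 0"
    unfolding on_axis_writhe_def using D(2) by (intro sum.neutral) auto
  ultimately show ?thesis
    by (simp add: W_def jones_def)
qed

theorem proposition1p7:
  fixes D :: "'e diagram" and out :: "dart \<Rightarrow> bool" and n :: nat
  assumes "symmetric_union D" and "orientation D out" and "card (components D) = n"
  shows "((\<forall>N\<in>set D. \<not> axis_crossing N) \<longrightarrow>
            W D out =
              ((sqrt_s + inverse sqrt_s) / (sqrt_t + inverse sqrt_t)) ^ (n - 1) * jones D out) \<and>
         (\<forall>i ul ll lr ur out_h out_v.
            i < length D \<and> D ! i = Over ul ll lr ur \<and>
            orientation (h_smoothing D i) out_h \<and> orientation (v_smoothing D i) out_v \<longrightarrow>
              W D out = - sqrt_s * W (h_smoothing D i) out_h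
                        - sqrt_s ^ 2 * W (v_smoothing D i) out_v) \<and>
         (\<forall>i ul ll lr ur out_h out_v.
            i < length D \<and> D ! i = Under ul ll lr ur \<and>
            orientation (h_smoothing D i) out_h \<and> orientation (v_smoothing D i) out_v \<longrightarrow>
              W D out = - inverse sqrt_s * W (h_smoothing D i) out_h
                        - inverse (sqrt_s ^ 2) * W (v_smoothing D i) out_v)"
proof -
  obtain r where r: "reflection D r" and rK: "\<forall>K\<in>components D. r ` K = K"
    and reverses: "\<forall>out. orientation D out \<longrightarrow> (\<forall>d\<in>darts (code D). out (r d) \<noteq> out d)"
    using assms(1) unfolding symmetric_union_def by (elim exE conjE) (rule that)
  note rev = mp[OF spec[OF reverses] assms(2)]
  have D: "D \<noteq> []" "paired (code D)"
    using assms(1) by (simp_all add: symmetric_union_def link_diagram_def)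
  \<comment> \<open>This identifies half the number of axis points with the number of components. As
    \<open>D\<close> is nonempty, \<open>n\<close> is positive and \<open>n - 1\<close> is not
    truncated.\<close>
  have n: "card (axis_points D) = 2 * n" "0 < n"
    using card_axis_points[OF r D(2) assms(2) rev rK] card_components_pos[OF D(1)] assms(3) by simp_all
  note skein = W_skein[OF r rK assms(2) rev]
  show ?thesis
  proof (intro conjI allI impI; (elim conjE)?)
    assume "\<forall>N\<in>set D. \<not> axis_crossing N"
    then show "W D out =
        ((sqrt_s + inverse sqrt_s) / (sqrt_t + inverse sqrt_t)) ^ (n - 1) * jones D out"
      using W_off_axis[OF D(1) _ n] by blast
  next
    fix i ul ll lr ur out_h out_v
    assume "i < length D" "orientation (h_smoothing D i) out_h"
      "orientation (v_smoothing D i) out_v" "D ! i = Over ul ll lr ur"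
    then show "W D out = - sqrt_s * W (h_smoothing D i) out_h - sqrt_s ^ 2 * W (v_smoothing D i) out_v"
      by (rule skein(1))
  next
    fix i ul ll lr ur out_h out_v
    assume "i < length D" "orientation (h_smoothing D i) out_h"
      "orientation (v_smoothing D i) out_v" "D ! i = Under ul ll lr ur"
    then show "W D out = - inverse sqrt_s * W (h_smoothing D i) out_h
        - inverse (sqrt_s ^ 2) * W (v_smoothing D i) out_v"
      by (rule skein(2))
  qed
qed

end
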